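(* Let $G$ be a group given by a finite presentation $\mathcal P=\langle X\mid R\rangle$ with cyclically reduced relators, and let $m:R\to\mathbb Z_{>0}$ be a multiplicity function such that $\mathcal P$ has the $m$-matching property. Suppose that every word in $X^{\pm1}$ representing $1\in G$ can be reduced to the empty word by a finite sequence of moves, each of which is either a (cyclic) free reduction, or the replacement of a subword of a relator $r$ by its complement $\sigma$ subject to the inequality $$n\cdot m(r)\ge |\sigma|,$$ where $n$ is the exponent of $r$. Then $G$ is coherent.
   Context: The incidence graph of $\mathcal P=\langle X\mid R\rangle$ is the bipartite graph with vertex set $R\sqcup X$ in which $r\in R$ and $x\in X$ are joined by an edge iff $x$ (or $x^{-1}$) occurs in the spelling of $r$. Given $m:R\to\mathbb Z_{>0}$, $\mathcal P$ has the $m$-matching property if for every subset $W\subseteq R$ the number of generators occurring in some relator of $W$ is at least $\sum_{r\in W}m(r)$. The exponent of a relator $r$ is the largest $n$ such that $r=u^n$ for some word $u$. Replacing a subword by its complement means: if some cyclic permutation of $r$ or $r^{-1}$ equals $uv$ and the current word contains $u$ as a subword, replace $u$ by $\sigma=v^{-1}$ (so $|\sigma|=|r|-|u|$). A group is coherent if every finitely generated subgroup is finitely presented. *)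

theory Defs
  imports "HOL-Algebra.Generated_Groups"
begin

text \<open>A letter is a generator together with a sign: (x, True) is x, (x, False) is x^-1.\<close>
type_synonym 'a word = "('a \<times> bool) list"

definition inv_letter :: "'a \<times> bool \<Rightarrow> 'a \<times> bool" where
  "inv_letter l = (fst l, \<not> snd l)"

definition inv_word :: "'a word \<Rightarrow> 'a word" where
  "inv_word w = rev (map inv_letter w)"

definition word_over :: "'a set \<Rightarrow> 'a word \<Rightarrow> bool" where
  "word_over X w \<longleftrightarrow> fst ` set w \<subseteq> X"

definition freely_reduced :: "'a word \<Rightarrow> bool" where
  "freely_reduced w \<longleftrightarrow> (\<forall>i. Suc i < length w \<longrightarrow> w ! Suc i \<noteq> inv_letter (w ! i))"

definition cyclically_reduced :: "'a word \<Rightarrow> bool" where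
  "cyclically_reduced w \<longleftrightarrow> freely_reduced w \<and>
     (w \<noteq> [] \<longrightarrow> last w \<noteq> inv_letter (hd w))"

inductive_set pres_rel :: "'a set \<Rightarrow> 'a word set \<Rightarrow> ('a word \<times> 'a word) set"
  for X R where
  refl: "word_over X w \<Longrightarrow> (w, w) \<in> pres_rel X R"
| sym: "(u, v) \<in> pres_rel X R \<Longrightarrow> (v, u) \<in> pres_rel X R"
| trans: "(u, v) \<in> pres_rel X R \<Longrightarrow> (v, w) \<in> pres_rel X R \<Longrightarrow> (u, w) \<in> pres_rel X R"
| cancel: "word_over X p \<Longrightarrow> word_over X q \<Longrightarrow> fst l \<in> X \<Longrightarrow>
     (p @ [l, inv_letter l] @ q, p @ q) \<in> pres_rel X R"
| relator: "word_over X p \<Longrightarrow> word_over X q \<Longrightarrow> r \<in> R \<Longrightarrow>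
     (p @ r @ q, p @ q) \<in> pres_rel X R"

definition pres_group :: "'a set \<Rightarrow> 'a word set \<Rightarrow> 'a word set monoid" where
  "pres_group X R = \<lparr> carrier = {w. word_over X w} // pres_rel X R,
     mult = (\<lambda>A B. pres_rel X R `` {a @ b | a b. a \<in> A \<and> b \<in> B}),
     one = pres_rel X R `` {[]} \<rparr>"

definition finite_presentation :: "'a set \<Rightarrow> 'a word set \<Rightarrow> bool" where
  "finite_presentation X R \<longleftrightarrow> finite X \<and> finite R \<and> (\<forall>r\<in>R. word_over X r)"

text \<open>A group is finitely presented if it is isomorphic to a group given by a finite
  presentation (generators may be taken among the naturals).\<close>
definition finitely_presented :: "('g, 'b) monoid_scheme \<Rightarrow> bool" where
  "finitely_presented H \<longleftrightarrow>
     (\<exists>(Y :: nat set) S. finite_presentation Y S \<and> pres_group Y S \<cong> H)"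

definition finitely_generated_subgroup :: "('g, 'b) monoid_scheme \<Rightarrow> 'g set \<Rightarrow> bool" where
  "finitely_generated_subgroup G H \<longleftrightarrow> subgroup H G \<and>
     (\<exists>A. finite A \<and> A \<subseteq> carrier G \<and> H = generate G A)"

definition coherent :: "('g, 'b) monoid_scheme \<Rightarrow> bool" where
  "coherent G \<longleftrightarrow> (\<forall>H. finitely_generated_subgroup G H \<longrightarrow>
     finitely_presented (G\<lparr>carrier := H\<rparr>))"

definition gens_of :: "'a word set \<Rightarrow> 'a set" where
  "gens_of W = {x. \<exists>r\<in>W. x \<in> fst ` set r}"

definition matching_property :: "'a set \<Rightarrow> 'a word set \<Rightarrow> ('a word \<Rightarrow> nat) \<Rightarrow> bool" where
  "matching_property X R m \<longleftrightarrow>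
     (\<forall>W \<subseteq> R. card (gens_of W \<inter> X) \<ge> (\<Sum>r\<in>W. m r))"

definition word_power :: "'a word \<Rightarrow> nat \<Rightarrow> 'a word" where
  "word_power u n = concat (replicate n u)"

definition exponent :: "'a word \<Rightarrow> nat" where
  "exponent r = (GREATEST n. \<exists>u. r = word_power u n)"

definition cyclic_perms :: "'a word \<Rightarrow> 'a word set" where
  "cyclic_perms r = {rotate k r | k. k < length r}"

inductive move :: "'a word set \<Rightarrow> ('a word \<Rightarrow> nat) \<Rightarrow> 'a word \<Rightarrow> 'a word \<Rightarrow> bool"
  for R m where
  free_red: "move R m (p @ [l, inv_letter l] @ q) (p @ q)"
| cyc_free_red: "move R m (l # w @ [inv_letter l]) w"
| complement: "r \<in> R \<Longrightarrow> u @ v \<in> cyclic_perms r \<union> cyclic_perms (inv_word r) \<Longrightarrow>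
     exponent r * m r \<ge> length (inv_word v) \<Longrightarrow>
     move R m (p @ u @ q) (p @ inv_word v @ q)"

end

theory Submission
  imports Defs
begin

text \<open>A finitely generated subgroup H is the fundamental group of the cover of the presentation
  complex whose vertices are the cosets of H. For a finite subcomplex with edge set E and set of
  cells F the perimeter is \<open>card E - (\<Sum>(v, r)\<in>F. m r)\<close>. It is never negative: each generator
  occurring in r sends the r-cells injectively to edges, so this is the matching property, counted
  fibre by fibre. Take a connected finite subcomplex of minimal perimeter that contains loops
  generating H. A move whose cell is not yet present attaches that cell. If the boundary of the
  cell covers a closed path of d periods, the weight grows by d m(r), and since r has exponent
  \<open>n \<ge> d\<close> and \<open>\<bar>\<sigma>\<bar> \<le> n m(r)\<close> there are at most d m(r) new edges. By minimality there are exactly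
  that many, so the new edges form one embedded path and attaching the cell does not change the
  fundamental group. Hence a loop that the moves reduce to the empty word was already trivial in
  the fundamental group of the first subcomplex, which is therefore a finite presentation of H.\<close>

section \<open>Presentations and evaluation of words\<close>

lemma word_over_simps [simp]:
  "word_over X []"
  "word_over X (l # w) \<longleftrightarrow> fst l \<in> X \<and> word_over X w"
  "word_over X (u @ v) \<longleftrightarrow> word_over X u \<and> word_over X v"
  by (auto simp: word_over_def)

lemma fst_inv_letter [simp]: "fst (inv_letter l) = fst l"
  by (simp add: inv_letter_def)

lemma snd_inv_letter [simp]: "snd (inv_letter l) \<longleftrightarrow> \<not> snd l"
  by (simp add: inv_letter_def)

lemma inv_letter_inv_letter [simp]: "inv_letter (inv_letter l) = l"
  by (simp add: inv_letter_def)

lemma inv_word_simps [simp]: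
  "inv_word [] = []"
  "inv_word (l # w) = inv_word w @ [inv_letter l]"
  "inv_word (u @ v) = inv_word v @ inv_word u"
  "length (inv_word w) = length w"
  "inv_word (inv_word w) = w"
  by (auto simp: inv_word_def rev_map comp_def)

lemma word_over_inv_word [simp]: "word_over X (inv_word w) \<longleftrightarrow> word_over X w"
  by (induction w) auto

lemma word_power_simps [simp]:
  "word_power u 0 = []"
  "word_power u (Suc n) = u @ word_power u n"
  by (auto simp: word_power_def)

lemma word_power_add: "word_power u (i + j) = word_power u i @ word_power u j"
  by (induction i) auto

lemma word_power_Suc_right: "word_power u (Suc n) = word_power u n @ u"
  using word_power_add[of u n 1] by simp

lemma word_power_mult: "word_power u (i * j) = word_power (word_power u i) j"
  by (induction j) (auto simp: word_power_add)

lemma length_word_power [simp]: "length (word_power u n) = n * length u"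
  by (induction n) auto

lemma word_power_conjugate: "a @ word_power (b @ a) n = word_power (a @ b) n @ a"
  by (induction n) auto

lemma inv_word_word_power: "inv_word (word_power u n) = word_power (inv_word u) n"
proof (induction n)
  case (Suc n)
  then show ?case using word_power_Suc_right[of "inv_word u" n] by simp
qed simp

section \<open>Evaluation of words in a group\<close>

definition letter_eval :: "('g, 'b) monoid_scheme \<Rightarrow> ('a \<Rightarrow> 'g) \<Rightarrow> 'a \<times> bool \<Rightarrow> 'g" where
  "letter_eval G f l = (if snd l then f (fst l) else inv\<^bsub>G\<^esub> (f (fst l)))"

fun word_eval :: "('g, 'b) monoid_scheme \<Rightarrow> ('a \<Rightarrow> 'g) \<Rightarrow> 'a word \<Rightarrow> 'g" where
  "word_eval G f [] = \<one>\<^bsub>G\<^esub>"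
| "word_eval G f (l # w) = letter_eval G f l \<otimes>\<^bsub>G\<^esub> word_eval G f w"

context group
begin

lemma letter_eval_closed [simp]:
  "f ` A \<subseteq> carrier G \<Longrightarrow> fst l \<in> A \<Longrightarrow> letter_eval G f l \<in> carrier G"
  by (auto simp: letter_eval_def)

lemma letter_eval_inv:
  "f ` A \<subseteq> carrier G \<Longrightarrow> fst l \<in> A \<Longrightarrow> letter_eval G f (inv_letter l) = inv (letter_eval G f l)"
  by (auto simp: letter_eval_def image_subset_iff)

lemma word_eval_closed [simp]:
  "f ` A \<subseteq> carrier G \<Longrightarrow> word_over A w \<Longrightarrow> word_eval G f w \<in> carrier G"
  by (induction w) auto

lemma word_eval_append:
  assumes "f ` A \<subseteq> carrier G" "word_over A u" "word_over A v"
  shows "word_eval G f (u @ v) = word_eval G f u \<otimes> word_eval G f v"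
  using assms(2) by (induction u) (use assms in \<open>auto simp: m_assoc\<close>)

lemma word_eval_inv_word:
  assumes "f ` A \<subseteq> carrier G" "word_over A w"
  shows "word_eval G f (inv_word w) = inv (word_eval G f w)"
  using assms(2)
  by (induction w)
    (use assms in \<open>auto simp: word_eval_append[of f A] letter_eval_inv[of f A] inv_mult_group\<close>)

lemma cancel_left: "x \<in> carrier G \<Longrightarrow> y \<in> carrier G \<Longrightarrow> x \<otimes> (inv x \<otimes> y) = y"
  by (simp add: m_assoc[symmetric])

text \<open>The easy half of von Dyck's theorem: each elementary step inserts or deletes a word of
  value one. It is what makes the map in \<open>pres_group_iso\<close> independent of
  representatives.\<close>

lemma word_eval_pres_rel:
  assumes "(u, v) \<in> pres_rel A S" "f ` A \<subseteq> carrier G"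
    and "\<And>r. r \<in> S \<Longrightarrow> word_over A r \<and> word_eval G f r = \<one>"
  shows "word_eval G f u = word_eval G f v"
  using assms(1)
proof induction
  case (cancel p q l)
  then show ?case
    using assms by (simp add: word_eval_append[of f A] letter_eval_inv[of f A] cancel_left)
next
  case (relator p q r)
  then show ?case
    using assms by (simp add: word_eval_append[of f A])
qed auto

lemma word_eval_cong:
  "\<forall>x\<in>fst ` set w. f x = g x \<Longrightarrow> word_eval G f w = word_eval G g w"
  by (induction w) (auto simp: letter_eval_def)

lemma word_eval_trivial:
  "\<forall>x\<in>fst ` set w. f x = \<one> \<Longrightarrow> word_eval G f w = \<one>"
  by (induction w) (auto simp: letter_eval_def)

lemma word_eval_subgroup:
  assumes "subgroup H G" "f ` A \<subseteq> H" "word_over A w"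
  shows "word_eval (G\<lparr>carrier := H\<rparr>) f w = word_eval G f w"
  using assms(3)
  by (induction w) (use assms(1,2) in \<open>auto simp: letter_eval_def m_inv_consistent image_subset_iff\<close>)

end

section \<open>The group defined by a presentation\<close>

locale presentation =
  fixes X :: "'a set" and R :: "'a word set"
  assumes relators_over: "r \<in> R \<Longrightarrow> word_over X r"
begin

abbreviation P where "P \<equiv> pres_group X R"
definition cls where "cls w = pres_rel X R `` {w}"

lemma pres_rel_word_over:
  "(u, v) \<in> pres_rel X R \<Longrightarrow> word_over X u \<and> word_over X v"
  by (induction rule: pres_rel.induct) (auto simp: relators_over)

lemma pres_rel_context:
  "(u, v) \<in> pres_rel X R \<Longrightarrow> word_over X p \<Longrightarrow> word_over X q \<Longrightarrow> (p @ u @ q, p @ v @ q) \<in> pres_rel X R"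
proof (induction rule: pres_rel.induct)
  case (cancel p' q' l)
  then show ?case using pres_rel.cancel[of X "p @ p'" "q' @ q" l R] by simp
next
  case (relator p' q' r)
  then show ?case using pres_rel.relator[of X "p @ p'" "q' @ q" r R] by simp
next
  case (refl w)
  then show ?case by (intro pres_rel.refl) simp
next
  case (sym u v)
  then show ?case using pres_rel.sym by simp
next
  case (trans u v w)
  then show ?case using pres_rel.trans[of _ "p @ v @ q"] by simp
qed

lemma pres_rel_append:
  assumes "(u, u') \<in> pres_rel X R" "(v, v') \<in> pres_rel X R"
  shows "(u @ v, u' @ v') \<in> pres_rel X R"
proof -
  have "(u @ v, u' @ v) \<in> pres_rel X R"
    using pres_rel_context[of u u' "[]" v] pres_rel_word_over assms by auto
  moreover have "(u' @ v, u' @ v') \<in> pres_rel X R"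
    using pres_rel_context[of v v' u' "[]"] pres_rel_word_over assms by auto
  ultimately show ?thesis by (rule pres_rel.trans)
qed

lemma pres_rel_inv_right: "word_over X w \<Longrightarrow> (w @ inv_word w, []) \<in> pres_rel X R"
proof (induction w)
  case (Cons l w)
  have "([l] @ (w @ inv_word w) @ [inv_letter l], [l] @ [] @ [inv_letter l]) \<in> pres_rel X R"
    using Cons by (intro pres_rel_context) auto
  moreover have "([l] @ [] @ [inv_letter l], []) \<in> pres_rel X R"
    using pres_rel.cancel[of X "[]" "[]" l R] Cons by simp
  ultimately have "([l] @ (w @ inv_word w) @ [inv_letter l], []) \<in> pres_rel X R"
    by (rule pres_rel.trans)
  then show ?case by simp
qed (simp add: pres_rel.refl)

lemma equiv_pres_rel: "equiv {w. word_over X w} (pres_rel X R)"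
proof (rule equivI)
  show "pres_rel X R \<subseteq> {w. word_over X w} \<times> {w. word_over X w}"
    using pres_rel_word_over by auto
  show "refl_on {w. word_over X w} (pres_rel X R)"
    by (rule refl_onI) (simp add: pres_rel.refl)
  show "sym (pres_rel X R)"
    by (rule symI) (rule pres_rel.sym)
  show "trans (pres_rel X R)"
    by (rule transI) (rule pres_rel.trans)
qed

lemma cls_eq_iff: "word_over X u \<Longrightarrow> word_over X v \<Longrightarrow> cls u = cls v \<longleftrightarrow> (u, v) \<in> pres_rel X R"
  using eq_equiv_class_iff[OF equiv_pres_rel] by (auto simp: cls_def)

lemma carrier_pres_group: "carrier P = cls ` {w. word_over X w}"
  by (auto simp: pres_group_def quotient_def cls_def)

lemma cls_closed [simp]: "word_over X w \<Longrightarrow> cls w \<in> carrier P"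
  by (auto simp: carrier_pres_group)

lemma one_pres_group: "\<one>\<^bsub>P\<^esub> = cls []"
  by (simp add: pres_group_def cls_def)

lemma mult_cls:
  assumes "word_over X u" "word_over X v"
  shows "cls u \<otimes>\<^bsub>P\<^esub> cls v = cls (u @ v)"
proof -
  have "cls u \<otimes>\<^bsub>P\<^esub> cls v = pres_rel X R `` {a @ b | a b. a \<in> cls u \<and> b \<in> cls v}"
    by (simp add: pres_group_def)
  also have "\<dots> = cls (u @ v)"
  proof (intro equalityI subsetI)
    fix w assume "w \<in> pres_rel X R `` {a @ b | a b. a \<in> cls u \<and> b \<in> cls v}"
    then obtain a b where "(u, a) \<in> pres_rel X R" "(v, b) \<in> pres_rel X R" "(a @ b, w) \<in> pres_rel X R"
      by (auto simp: cls_def)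
    then have "(u @ v, w) \<in> pres_rel X R" using pres_rel_append pres_rel.trans by blast
    then show "w \<in> cls (u @ v)" by (simp add: cls_def)
  next
    fix w assume "w \<in> cls (u @ v)"
    then show "w \<in> pres_rel X R `` {a @ b | a b. a \<in> cls u \<and> b \<in> cls v}"
      using assms by (auto simp: cls_def intro: pres_rel.refl)
  qed
  finally show ?thesis .
qed

lemma group_pres_group: "group P"
proof (rule groupI)
  fix x assume "x \<in> carrier P"
  then obtain w where w: "x = cls w" "word_over X w" by (auto simp: carrier_pres_group)
  then have "cls (inv_word w) \<otimes>\<^bsub>P\<^esub> x = \<one>\<^bsub>P\<^esub>"
    using pres_rel_inv_right[of "inv_word w"] by (simp add: mult_cls one_pres_group cls_eq_iff)
  then show "\<exists>y\<in>carrier P. y \<otimes>\<^bsub>P\<^esub> x = \<one>\<^bsub>P\<^esub>" using w by (intro bexI) auto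
qed (auto simp: carrier_pres_group mult_cls one_pres_group)

abbreviation gen where "gen x \<equiv> cls [(x, True)]"

lemma gen_closed: "gen ` X \<subseteq> carrier P"
  by auto

lemma letter_eval_gen:
  assumes "fst l \<in> X" shows "letter_eval P gen l = cls [l]"
proof -
  interpret group P by (rule group_pres_group)
  obtain x s where l: "l = (x, s)" by (cases l)
  have "cls [(x, False)] \<otimes>\<^bsub>P\<^esub> cls [(x, True)] = \<one>\<^bsub>P\<^esub>"
    using pres_rel_inv_right[of "[(x, False)]"] assms l
    by (simp add: mult_cls one_pres_group cls_eq_iff inv_letter_def)
  then have "inv\<^bsub>P\<^esub> (gen x) = cls [(x, False)]"
    using assms l by (intro inv_equality) auto
  then show ?thesis using l by (auto simp: letter_eval_def)
qed

lemma word_eval_gen: "word_over X w \<Longrightarrow> word_eval P gen w = cls w"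
  by (induction w) (auto simp: letter_eval_gen mult_cls one_pres_group)

lemma word_eval_gen_eq_one:
  "word_over X w \<Longrightarrow> word_eval P gen w = \<one>\<^bsub>P\<^esub> \<longleftrightarrow> (w, []) \<in> pres_rel X R"
  by (simp add: word_eval_gen one_pres_group cls_eq_iff)

lemma cls_append: "word_over X u \<Longrightarrow> word_over X v \<Longrightarrow> cls (u @ v) = cls u \<otimes>\<^bsub>P\<^esub> cls v"
  by (simp add: mult_cls)

lemma cls_inv_word:
  assumes "word_over X w"
  shows "cls (inv_word w) = inv\<^bsub>P\<^esub> cls w"
proof -
  interpret group P by (rule group_pres_group)
  show ?thesis
    using word_eval_inv_word[OF gen_closed assms] assms by (simp add: word_eval_gen)
qed

lemma cls_relator: "r \<in> R \<Longrightarrow> cls r = \<one>\<^bsub>P\<^esub>"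
  using pres_rel.relator[of X "[]" "[]" r R] relators_over by (simp add: one_pres_group cls_eq_iff)

text \<open>A criterion in terms of words only: \<open>rel\<close> lets evaluation descend to
  classes, \<open>surj\<close> and \<open>ker\<close> make the induced homomorphism
  bijective.\<close>

lemma pres_group_iso:
  assumes "group H" "f ` X \<subseteq> carrier H"
    and rel: "\<And>r. r \<in> R \<Longrightarrow> word_eval H f r = \<one>\<^bsub>H\<^esub>"
    and surj: "\<And>h. h \<in> carrier H \<Longrightarrow> \<exists>w. word_over X w \<and> word_eval H f w = h"
    and ker: "\<And>w. word_over X w \<Longrightarrow> word_eval H f w = \<one>\<^bsub>H\<^esub> \<Longrightarrow> (w, []) \<in> pres_rel X R"
  shows "P \<cong> H"
proof -
  interpret H: group H by fact
  interpret P: group P by (rule group_pres_group)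
  \<comment> \<open>Choice picks a representative of the class; the next fact shows that the value
    does not depend on it.\<close>
  define \<phi> where "\<phi> c = word_eval H f (SOME w. w \<in> c)" for c
  have \<phi>: "\<phi> (cls w) = word_eval H f w" if "word_over X w" for w
  proof -
    have "w \<in> cls w" using that by (simp add: cls_def pres_rel.refl)
    then have "(SOME w'. w' \<in> cls w) \<in> cls w" by (rule someI)
    then have "(w, SOME w'. w' \<in> cls w) \<in> pres_rel X R" by (simp add: cls_def)
    from H.word_eval_pres_rel[OF this assms(2)] show ?thesis
      unfolding \<phi>_def using relators_over rel by metis
  qed
  have hom: "\<phi> \<in> hom P H"
  proof (rule homI)
    show "\<phi> c \<in> carrier H" if "c \<in> carrier P" for c
      using that assms(2) by (auto simp: carrier_pres_group \<phi>)
    show "\<phi> (c \<otimes>\<^bsub>P\<^esub> d) = \<phi> c \<otimes>\<^bsub>H\<^esub> \<phi> d" if "c \<in> carrier P" "d \<in> carrier P" for c d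
      using that assms(2) by (auto simp: carrier_pres_group \<phi> mult_cls H.word_eval_append[of f X])
  qed
  interpret group_hom P H \<phi>
    by (rule group_hom.intro) (auto intro: group_hom_axioms.intro hom P.is_group H.is_group)
  have "\<exists>c\<in>carrier P. h = \<phi> c" if "h \<in> carrier H" for h
  proof -
    obtain w where "word_over X w" "word_eval H f w = h" using surj[OF \<open>h \<in> carrier H\<close>] by blast
    then show ?thesis using \<phi>[of w] cls_closed[of w] by (intro bexI[of _ "cls w"]) auto
  qed
  then have "carrier H \<subseteq> \<phi> ` carrier P" by blast
  moreover have "c = \<one>\<^bsub>P\<^esub>" if c: "c \<in> carrier P" "\<phi> c = \<one>\<^bsub>H\<^esub>" for c
  proof -
    obtain w where w: "c = cls w" "word_over X w" using c(1) carrier_pres_group by auto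
    with c(2) have "(w, []) \<in> pres_rel X R" using ker \<phi> by simp
    with w show ?thesis by (simp add: one_pres_group cls_eq_iff)
  qed
  then have "inj_on \<phi> (carrier P)"
    using inj_on_one_iff by blast
  ultimately have "\<phi> \<in> iso P H"
    using hom by (auto simp: iso_def bij_betw_def)
  then show ?thesis by (rule is_isoI)
qed

end

section \<open>Renaming of generators\<close>

lemma word_over_map: "word_over A w \<Longrightarrow> word_over (g ` A) (map (apfst g) w)"
  by (induction w) auto

lemma pres_rel_map:
  assumes "(u, v) \<in> pres_rel A S"
  shows "(map (apfst g) u, map (apfst g) v) \<in> pres_rel (g ` A) (map (apfst g) ` S)"
  using assms
proof induction
  case (cancel p q l)
  have "apfst g (inv_letter l) = inv_letter (apfst g l)" by (simp add: inv_letter_def prod_eq_iff)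
  then show ?case
    using pres_rel.cancel[of "g ` A" "map (apfst g) p" "map (apfst g) q" "apfst g l" "map (apfst g) ` S"] cancel
    by (simp add: word_over_map)
next
  case (relator p q r)
  then show ?case
    using pres_rel.relator[of "g ` A" "map (apfst g) p" "map (apfst g) q" "map (apfst g) r" "map (apfst g) ` S"] relator
    by (simp add: word_over_map)
next
  case (refl w)
  show ?case by (rule pres_rel.refl) (rule word_over_map[OF refl])
next
  case (sym u v)
  show ?case by (rule pres_rel.sym) (rule sym.IH)
next
  case (trans u v w)
  show ?case by (rule pres_rel.trans) (rule trans.IH)+
qed

lemma word_eval_map: "word_eval H f (map (apfst g) w) = word_eval H (f \<circ> g) w"
  by (induction w) (auto simp: letter_eval_def)

text \<open>\<open>finitely_presented\<close> asks for generators of type \<open>nat\<close>,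
  whereas the generators used later are edges of a graph. An injection of the finite set
  \<open>A\<close> into \<open>nat\<close> renames them, and then \<open>pres_group_iso\<close>
  applies.\<close>

lemma finitely_presentedI:
  fixes A :: "'b set"
  assumes "group H" "finite A" "finite S" "\<And>r. r \<in> S \<Longrightarrow> word_over A r" "f ` A \<subseteq> carrier H"
    and rel: "\<And>r. r \<in> S \<Longrightarrow> word_eval H f r = \<one>\<^bsub>H\<^esub>"
    and surj: "\<And>h. h \<in> carrier H \<Longrightarrow> \<exists>w. word_over A w \<and> word_eval H f w = h"
    and ker: "\<And>w. word_over A w \<Longrightarrow> word_eval H f w = \<one>\<^bsub>H\<^esub> \<Longrightarrow> (w, []) \<in> pres_rel A S"
  shows "finitely_presented H"
proof -
  obtain g :: "'b \<Rightarrow> nat" where g: "inj_on g A"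
    using finite_imp_inj_to_nat_seg[OF assms(2)] by auto
  define h where "h = the_inv_into A g"
  have hg: "h (g a) = a" if "a \<in> A" for a using g that by (simp add: h_def the_inv_into_f_f)
  interpret group H by fact
  let ?m = "map (apfst g)"
  note over = word_over_map[of A _ g]
  have inverse: "?m (map (apfst h) w) = w \<and> word_over A (map (apfst h) w)" if "word_over (g ` A) w" for w
    using that by (induction w) (auto simp: hg)
  have ev: "word_eval H (f \<circ> h) (?m w) = word_eval H f w" if "word_over A w" for w
    unfolding word_eval_map
    by (rule word_eval_cong) (use that in \<open>auto simp: word_over_def hg subset_iff\<close>)
  interpret Q: presentation "g ` A" "?m ` S"
    by unfold_locales (use over assms in auto)
  have "pres_group (g ` A) (?m ` S) \<cong> H"
  proof (rule Q.pres_group_iso[where f = "f \<circ> h"])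
    show "(f \<circ> h) ` g ` A \<subseteq> carrier H" using assms(5) by (auto simp: hg)
    show "word_eval H (f \<circ> h) r = \<one>\<^bsub>H\<^esub>" if "r \<in> ?m ` S" for r
      using that ev assms(4) rel by auto
    show "\<exists>w. word_over (g ` A) w \<and> word_eval H (f \<circ> h) w = x" if "x \<in> carrier H" for x
      using surj[OF that] ev over by metis
    show "(w, []) \<in> pres_rel (g ` A) (?m ` S)"
      if "word_over (g ` A) w" "word_eval H (f \<circ> h) w = \<one>\<^bsub>H\<^esub>" for w
    proof -
      let ?w = "map (apfst h) w"
      have "(?w, []) \<in> pres_rel A S" using ker[of ?w] inverse[of w] ev[of ?w] that by auto
      from pres_rel_map[OF this, of g] show ?thesis using inverse[of w] that by simp
    qed
  qed fact
  then show ?thesis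
    unfolding finitely_presented_def finite_presentation_def using Q.relators_over assms(2,3) by blast
qed

section \<open>Roots, periods and matchings\<close>

text \<open>If a nonempty \<open>r\<close> is a power of \<open>u\<close>, then \<open>u\<close> is
  nonempty and the number of factors is at most the length of \<open>r\<close>, so the maximum in
  \<open>GREATEST\<close> is attained. The empty word is a power with any number of factors, which
  is why it is excluded.\<close>

lemma exponent_power:
  assumes "r \<noteq> []"
  shows "exponent r > 0" "\<exists>u. r = word_power u (exponent r)"
proof -
  have *: "\<exists>u. r = word_power u (exponent r)"
    unfolding exponent_def
  proof (rule GreatestI_nat)
    show "\<exists>u. r = word_power u 1" by (intro exI[of _ r]) simp
    show "n \<le> length r" if n: "\<exists>u. r = word_power u n" for n
    proof -
      obtain u where u: "r = word_power u n" using n by blast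
      with assms have "u \<noteq> []" by (induction n) auto
      then have "n * 1 \<le> n * length u" by (intro mult_le_mono) (auto simp: Suc_le_eq)
      then show ?thesis using u by simp
    qed
  qed
  show "\<exists>u. r = word_power u (exponent r)" by fact
  then show "exponent r > 0" using assms by (cases "exponent r") auto
qed

definition root :: "'a word \<Rightarrow> 'a word" where
  "root r = (SOME u. r = word_power u (exponent r))"

lemma word_power_root: "r \<noteq> [] \<Longrightarrow> word_power (root r) (exponent r) = r"
  unfolding root_def using someI_ex[OF exponent_power(2)] by metis

lemma rotate1_word_power: "rotate1 (word_power (l # t) n) = word_power (t @ [l]) n"
  by (cases n) (use word_power_conjugate[of "[l]" t] in auto)

lemma rotate_word_power:
  "\<exists>a b. y = a @ b \<and> rotate k (word_power y n) = word_power (b @ a) n"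
proof (induction k)
  case 0
  show ?case by (rule exI[of _ "[]"], rule exI[of _ y]) simp
next
  case (Suc k)
  then obtain a b where ab: "y = a @ b" "rotate k (word_power y n) = word_power (b @ a) n"
    by blast
  show ?case
  proof (cases b)
    case (Cons l b')
    then show ?thesis
      using ab by (intro exI[of _ "a @ [l]"] exI[of _ b']) (simp add: rotate1_word_power)
  next
    \<comment> \<open>The rotation has come back to the beginning of \<open>y\<close>, so the split
      starts afresh with the first letter of \<open>a\<close>.\<close>
    case Nil
    show ?thesis
    proof (cases a)
      case (Cons l a')
      then show ?thesis
        using ab Nil by (intro exI[of _ "[l]"] exI[of _ a']) (simp add: rotate1_word_power)
    next
      case Nil2: Nil
      have "word_power [] n = []" by (induction n) auto
      then show ?thesis using ab Nil Nil2 by simp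
    qed
  qed
qed

text \<open>\<open>d\<close> is the least positive period. It divides \<open>n\<close> because the
  remainder \<open>n mod d\<close> is again a period, and minimality makes the first
  \<open>d\<close> iterates distinct.\<close>

lemma periodic_orbit:
  fixes f :: "'b \<Rightarrow> 'b"
  assumes "(f ^^ n) v = v" "n > 0"
  obtains d where "0 < d" "d dvd n" "(f ^^ d) v = v"
    "finite (range (\<lambda>j. (f ^^ j) v))" "card (range (\<lambda>j. (f ^^ j) v)) = d"
proof -
  define d where "d = (LEAST k. k > 0 \<and> (f ^^ k) v = v)"
  have d: "d > 0" "(f ^^ d) v = v"
    using LeastI[of "\<lambda>k. k > 0 \<and> (f ^^ k) v = v" n] assms by (auto simp: d_def)
  have min: "\<not> (0 < k \<and> k < d \<and> (f ^^ k) v = v)" for k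
    using not_less_Least[of k "\<lambda>k. k > 0 \<and> (f ^^ k) v = v"] by (auto simp: d_def)
  have md: "(f ^^ (k mod d)) v = (f ^^ k) v" for k
    using d(2) by (rule funpow_mod_eq)
  have "d dvd n"
    using min[of "n mod d"] md[of n] assms d(1) by (auto simp: dvd_eq_mod_eq_0)
  moreover have range: "range (\<lambda>j. (f ^^ j) v) = (\<lambda>j. (f ^^ j) v) ` {..<d}"
  proof (intro equalityI subsetI)
    fix x assume "x \<in> range (\<lambda>j. (f ^^ j) v)"
    then obtain j where "x = (f ^^ j) v" by blast
    then show "x \<in> (\<lambda>j. (f ^^ j) v) ` {..<d}"
      using md[of j] d(1) by (intro image_eqI[of _ _ "j mod d"]) auto
  qed auto
  \<comment> \<open>Applying \<open>f\<close> another \<open>d - j\<close> times turns a coincidence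
    into the positive period \<open>d - j + i\<close>, which is below \<open>d\<close>.\<close>
  moreover have neq: "(f ^^ i) v \<noteq> (f ^^ j) v" if "i < j" "j < d" for i j
  proof
    assume "(f ^^ i) v = (f ^^ j) v"
    then have "(f ^^ (d - j + i)) v = (f ^^ (d - j + j)) v" by (simp only: funpow_add comp_apply)
    then have "(f ^^ (d - j + i)) v = v" using that d by simp
    then show False using min[of "d - j + i"] d that by auto
  qed
  then have "inj_on (\<lambda>j. (f ^^ j) v) {..<d}"
    by (intro linorder_inj_onI) auto
  ultimately show ?thesis using that d by (simp add: card_image)
qed

text \<open>The equality case of a count: the set of a list never has more elements than the list is
  long. It later turns a count of new edges into an embedded path.\<close>

lemma card_set_diff_ge_length:
  assumes "length xs \<le> card (set xs - E)"
  shows "distinct xs" "set xs \<inter> E = {}"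
proof -
  have "card (set xs - E) \<le> card (set xs)" by (intro card_mono) auto
  then have c: "card (set xs) = length xs" "card (set xs - E) = card (set xs)"
    using assms card_length[of xs] by linarith+
  show "distinct xs" by (rule card_distinct) (rule c)
  have "set xs - E = set xs" by (rule card_subset_eq) (use c in auto)
  then show "set xs \<inter> E = {}" by auto
qed

text \<open>Slicing both sides at every height t turns the inequality into the matching property
  for the superlevel sets of a.\<close>

lemma matching_layer_cake:
  fixes a :: "'a word \<Rightarrow> nat" and e :: "'a \<Rightarrow> nat"
  assumes "finite X" "finite R" "matching_property X R m"
    and le: "\<And>r x. r \<in> R \<Longrightarrow> x \<in> X \<Longrightarrow> x \<in> fst ` set r \<Longrightarrow> a r \<le> e x"
  shows "(\<Sum>r\<in>R. m r * a r) \<le> (\<Sum>x\<in>X. e x)"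
proof -
  \<comment> \<open>A common bound for the heights: slicing up to \<open>N\<close> loses nothing
    from \<open>a\<close>, and on the other side it only replaces \<open>e x\<close> by the smaller
    \<open>min (e x) N\<close>.\<close>
  define N where "N = (\<Sum>r\<in>R. a r)"
  have aN: "a r \<le> N" if "r \<in> R" for r
    unfolding N_def using that assms(2) by (intro member_le_sum) auto
  have slice: "(\<Sum>t\<in>{1..N}. if t \<le> k then c else 0) = c * min k N" for k c :: nat
  proof -
    have "(\<Sum>t\<in>{1..N}. if t \<le> k then c else 0) = (\<Sum>t\<in>{1..min k N}. c)"
      by (intro sum.mono_neutral_cong_right) auto
    then show ?thesis by simp
  qed
  have "(\<Sum>r\<in>R. m r * a r) = (\<Sum>r\<in>R. \<Sum>t\<in>{1..N}. if t \<le> a r then m r else 0)"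
  proof (rule sum.cong)
    fix r assume "r \<in> R"
    then show "m r * a r = (\<Sum>t\<in>{1..N}. if t \<le> a r then m r else 0)"
      unfolding slice using aN[of r] by (simp add: min_absorb1)
  qed simp
  also have "\<dots> = (\<Sum>t\<in>{1..N}. \<Sum>r\<in>R. if t \<le> a r then m r else 0)"
    by (rule sum.swap)
  also have "\<dots> = (\<Sum>t\<in>{1..N}. \<Sum>r\<in>{r\<in>R. t \<le> a r}. m r)"
    by (intro sum.cong refl sum.mono_neutral_cong_right) (use assms(2) in auto)
  also have "\<dots> \<le> (\<Sum>t\<in>{1..N}. card (gens_of {r\<in>R. t \<le> a r} \<inter> X))"
    by (intro sum_mono) (use assms(3) in \<open>auto simp: matching_property_def\<close>)
  also have "\<dots> \<le> (\<Sum>t\<in>{1..N}. card {x\<in>X. t \<le> e x})"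
  proof (intro sum_mono card_mono)
    fix t
    show "gens_of {r\<in>R. t \<le> a r} \<inter> X \<subseteq> {x\<in>X. t \<le> e x}"
    proof
      fix x assume "x \<in> gens_of {r\<in>R. t \<le> a r} \<inter> X"
      then obtain r where "r \<in> R" "t \<le> a r" "x \<in> fst ` set r" "x \<in> X"
        unfolding gens_of_def by blast
      then show "x \<in> {x\<in>X. t \<le> e x}" using le[of r x] by simp
    qed
  qed (use assms(1) in auto)
  also have "\<dots> = (\<Sum>t\<in>{1..N}. \<Sum>x\<in>X. if t \<le> e x then 1 else 0)"
    by (simp only: card_eq_sum sum.inter_filter[OF assms(1)])
  also have "\<dots> = (\<Sum>x\<in>X. \<Sum>t\<in>{1..N}. if t \<le> e x then 1 else 0)"
    by (rule sum.swap)
  also have "\<dots> = (\<Sum>x\<in>X. min (e x) N)"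
    by (simp only: slice mult_1)
  also have "\<dots> \<le> (\<Sum>x\<in>X. e x)"
    by (intro sum_mono) auto
  finally show ?thesis .
qed

section \<open>Actions of letters and lifts of words\<close>

text \<open>Every letter acts as a bijection, and its formal inverse as the inverse bijection. The
  vertices thus form a labelled graph in which each word has exactly one lift from each
  vertex.\<close>

locale letter_action =
  fixes act :: "'v \<Rightarrow> 'a \<times> bool \<Rightarrow> 'v"
  assumes act_inv_letter [simp]: "act (act v l) (inv_letter l) = v"
begin

abbreviation path where "path \<equiv> foldl act"

lemma act_inv_letter' [simp]: "act (act v (inv_letter l)) l = v"
  using act_inv_letter[of v "inv_letter l"] by simp

lemma path_inv_word [simp]: "path (path v w) (inv_word w) = v"
  by (induction w arbitrary: v) auto

lemma path_inv_word' [simp]: "path (path v (inv_word w)) w = v"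
  using path_inv_word[of v "inv_word w"] by simp

lemma path_cancel [simp]: "path u w = path v w \<longleftrightarrow> u = v"
  by (metis path_inv_word)

lemma path_word_power: "path v (word_power u j) = ((\<lambda>v. path v u) ^^ j) v"
proof (induction j arbitrary: v)
  case (Suc j)
  then show ?case using funpow_swap1[of "\<lambda>v. path v u" j v] by simp
qed simp

lemma path_word_power_fix: "path v u = v \<Longrightarrow> path v (word_power u j) = v"
  by (induction j) auto

text \<open>The edge (v, x) runs from v to \<^term>\<open>act v (x, True)\<close>; a negative letter traverses the
  edge that ends where the letter starts.\<close>

definition lift_letter :: "'v \<Rightarrow> 'a \<times> bool \<Rightarrow> ('v \<times> 'a) \<times> bool" where
  "lift_letter v l = ((if snd l then v else act v l, fst l), snd l)"

fun lift_word :: "'v \<Rightarrow> 'a word \<Rightarrow> ('v \<times> 'a) word" where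
  "lift_word v [] = []"
| "lift_word v (l # w) = lift_letter v l # lift_word (act v l) w"

definition edges :: "'v \<Rightarrow> 'a word \<Rightarrow> ('v \<times> 'a) set" where
  "edges v w = fst ` set (lift_word v w)"

lemma lift_letter_inv: "lift_letter (act v l) (inv_letter l) = inv_letter (lift_letter v l)"
  by (auto simp: lift_letter_def inv_letter_def prod_eq_iff simp flip: inv_letter_def)

lemma lift_word_append [simp]: "lift_word v (u @ w) = lift_word v u @ lift_word (path v u) w"
  by (induction u arbitrary: v) auto

lemma lift_word_inv: "lift_word (path v w) (inv_word w) = inv_word (lift_word v w)"
  by (induction w arbitrary: v) (auto simp: lift_letter_inv)

lemma length_lift_word [simp]: "length (lift_word v w) = length w"
  by (induction w arbitrary: v) auto

lemma edges_simps [simp]: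
  "edges v [] = {}"
  "edges v (l # w) = insert (fst (lift_letter v l)) (edges (act v l) w)"
  "edges v (u @ w) = edges v u \<union> edges (path v u) w"
  by (auto simp: edges_def)

lemma finite_edges [simp]: "finite (edges v w)"
  by (simp add: edges_def)

lemma edges_inv: "edges (path v w) (inv_word w) = edges v w"
  unfolding edges_def lift_word_inv by (force simp: inv_word_def image_iff)

lemma word_over_lift_word: "word_over E (lift_word v w) \<longleftrightarrow> edges v w \<subseteq> E"
  by (simp add: word_over_def edges_def)

lemma edges_over: "word_over X w \<Longrightarrow> edges v w \<subseteq> UNIV \<times> X"
  by (induction w arbitrary: v) (auto simp: lift_letter_def)

lemma word_over_edges: "edges v w \<subseteq> UNIV \<times> X \<Longrightarrow> word_over X w"
  by (induction w arbitrary: v) (auto simp: lift_letter_def)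

text \<open>Fix one occurrence of \<open>x\<close> in \<open>r\<close>. The edge it traverses
  determines the vertex where \<open>r\<close> starts, because paths can be run backwards.\<close>

lemma generator_edge_inj:
  assumes "x \<in> fst ` set r"
  obtains g where "inj g" "\<And>v. (g v, x) \<in> edges v r"
proof -
  obtain l where l: "l \<in> set r" "fst l = x" using assms by auto
  then obtain p q where r: "r = p @ l # q" by (metis split_list)
  define g where "g v = (if snd l then path v p else act (path v p) l)" for v
  have "inj g"
    unfolding g_def by (rule injI) (metis act_inv_letter path_cancel)
  moreover have "(g v, x) \<in> edges v r" for v
    using r l by (simp add: lift_letter_def g_def)
  ultimately show ?thesis using that by blast
qed

text \<open>For closed paths, such a \<open>Q\<close> depends only on the cycle without its base
  point and orientation. It can therefore be tested on a relator instead of on a cyclic permutation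
  of the relator or of its inverse.\<close>

definition loop_property :: "('v \<Rightarrow> 'a word \<Rightarrow> bool) \<Rightarrow> bool" where
  "loop_property Q \<longleftrightarrow>
     (\<forall>v a b. path v (a @ b) = v \<longrightarrow> Q v (a @ b) \<longrightarrow> Q (path v a) (b @ a)) \<and>
     (\<forall>v q. path v q = v \<longrightarrow> Q v q \<longrightarrow> Q v (inv_word q))"

lemma loop_property_rotate:
  "loop_property Q \<Longrightarrow> path v (a @ b) = v \<Longrightarrow> Q v (a @ b) \<Longrightarrow> Q (path v a) (b @ a)"
  by (simp add: loop_property_def)

lemma loop_property_rotate_iff:
  assumes "loop_property Q" "path v (a @ b) = v"
  shows "Q (path v a) (b @ a) \<longleftrightarrow> Q v (a @ b)"
  using loop_property_rotate[OF assms(1), of v a b] loop_property_rotate[OF assms(1), of "path v a" b a]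
    assms(2) by auto

lemma loop_property_inv_iff:
  assumes "loop_property Q" "path v q = v"
  shows "Q v (inv_word q) \<longleftrightarrow> Q v q"
proof -
  have "path v (inv_word q) = v" using assms(2) by (metis path_inv_word)
  then show ?thesis using assms unfolding loop_property_def by (metis inv_word_simps(5))
qed

text \<open>The word \<open>a\<close> leads from the base point of the power of \<open>y\<close> to
  that of its rotation \<open>c\<close>, and \<open>z\<close> is the period rotated accordingly. The
  last clause transfers closedness after \<open>j\<close> periods.\<close>

lemma cyclic_perm_word_power:
  assumes "c \<in> cyclic_perms (word_power y n)" "n > 0" and closed: "\<And>v. path v (word_power y n) = v"
  obtains a z where "c = word_power z n" "length z = length y"
    "\<And>Q v. loop_property Q \<Longrightarrow> Q (path v a) c \<longleftrightarrow> Q v (word_power y n)"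
    "\<And>v j. path v (word_power y j) = v \<Longrightarrow> path (path v a) (word_power z j) = path v a"
proof -
  obtain k where k: "c = rotate k (word_power y n)"
    using assms(1) by (auto simp: cyclic_perms_def)
  obtain a b where ab: "y = a @ b" "c = word_power (b @ a) n"
    using rotate_word_power[of y k n] k by auto
  obtain n' where n: "n = Suc n'" using assms(2) by (cases n) auto
  define B where "B = b @ word_power (a @ b) n'"
  have y: "word_power y n = a @ B" by (simp add: n ab B_def)
  have c: "c = B @ a" by (simp add: n ab B_def word_power_conjugate)
  have "Q (path v a) c \<longleftrightarrow> Q v (word_power y n)" if "loop_property Q" for Q v
    unfolding y c using that closed[of v] y by (intro loop_property_rotate_iff) auto
  moreover have "path (path v a) (word_power (b @ a) j) = path v a"
    if "path v (word_power y j) = v" for v j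
    using that ab word_power_conjugate[of a b j] by (metis foldl_append)
  ultimately show ?thesis using that[of "b @ a" a] ab by auto
qed

section \<open>Labellings of edges by group elements\<close>

lemma word_eval_lift_append:
  assumes "group K" "\<phi> ` E \<subseteq> carrier K" "edges v (u @ w) \<subseteq> E"
  shows "word_eval K \<phi> (lift_word v (u @ w)) =
    word_eval K \<phi> (lift_word v u) \<otimes>\<^bsub>K\<^esub> word_eval K \<phi> (lift_word (path v u) w)"
  using group.word_eval_append[OF assms(1,2)] assms(3) by (simp add: word_over_lift_word)

lemma word_eval_lift_inv:
  assumes "group K" "\<phi> ` E \<subseteq> carrier K" "edges v w \<subseteq> E"
  shows "word_eval K \<phi> (lift_word (path v w) (inv_word w)) = inv\<^bsub>K\<^esub> word_eval K \<phi> (lift_word v w)"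
  unfolding lift_word_inv
  using group.word_eval_inv_word[OF assms(1,2)] assms(3) by (simp add: word_over_lift_word)

lemma word_eval_lift_closed:
  assumes "group K" "\<phi> ` E \<subseteq> carrier K" "edges v w \<subseteq> E"
  shows "word_eval K \<phi> (lift_word v w) \<in> carrier K"
  using group.word_eval_closed[OF assms(1,2)] assms(3) by (simp add: word_over_lift_word)

lemma word_eval_lift_cong:
  assumes "group K" "edges v w \<subseteq> E" "\<And>e. e \<in> E \<Longrightarrow> \<psi> e = \<phi> e"
  shows "word_eval K \<psi> (lift_word v w) = word_eval K \<phi> (lift_word v w)"
  by (rule group.word_eval_cong[OF assms(1)]) (use assms in \<open>auto simp: edges_def\<close>)

definition null_loop :: "('v \<times> 'a) set \<Rightarrow> ('k, 'b) monoid_scheme \<Rightarrow> ('v \<times> 'a \<Rightarrow> 'k) \<Rightarrow> 'v \<Rightarrow> 'a word \<Rightarrow> bool" where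
  "null_loop E K \<phi> v q \<longleftrightarrow> edges v q \<subseteq> E \<and> word_eval K \<phi> (lift_word v q) = \<one>\<^bsub>K\<^esub>"

text \<open>A change of base point replaces a product \<open>x y\<close> by \<open>y x\<close>, and
  these are trivial together; a change of orientation inverts the value.\<close>

lemma loop_property_null_loop:
  assumes "group K" "\<phi> ` E \<subseteq> carrier K"
  shows "loop_property (null_loop E K \<phi>)"
  unfolding loop_property_def
proof (intro conjI allI impI)
  interpret group K by fact
  fix v a b assume closed: "path v (a @ b) = v" and null: "null_loop E K \<phi> v (a @ b)"
  let ?a = "word_eval K \<phi> (lift_word v a)" and ?b = "word_eval K \<phi> (lift_word (path v a) b)"
  have sub: "edges v (a @ b) \<subseteq> E" "edges (path v a) (b @ a) \<subseteq> E"
    using null closed by (auto simp: null_loop_def)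
  have "?a \<otimes>\<^bsub>K\<^esub> ?b = \<one>\<^bsub>K\<^esub>"
    using null word_eval_lift_append[OF assms sub(1)] by (simp add: null_loop_def)
  then have "?b \<otimes>\<^bsub>K\<^esub> ?a = \<one>\<^bsub>K\<^esub>"
    using inv_comm word_eval_lift_closed[OF assms] sub by auto
  then show "null_loop E K \<phi> (path v a) (b @ a)"
    unfolding null_loop_def using word_eval_lift_append[OF assms sub(2)] sub(2) closed by simp
next
  interpret group K by fact
  fix v q assume closed: "path v q = v" and null: "null_loop E K \<phi> v q"
  then show "null_loop E K \<phi> v (inv_word q)"
    using word_eval_lift_inv[OF assms, of v q] edges_inv[of v q] by (simp add: null_loop_def)
qed

lemma loop_property_edges: "loop_property (\<lambda>v q. edges v q \<subseteq> E)"
  unfolding loop_property_def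
proof (intro conjI allI impI)
  fix v q assume "path v q = v" "edges v q \<subseteq> E"
  then show "edges v (inv_word q) \<subseteq> E" using edges_inv[of v q] by simp
qed auto

lemma edges_word_power_subset: "path v u = v \<Longrightarrow> edges v (word_power u k) \<subseteq> edges v u"
  by (induction k) auto

section \<open>Connectedness\<close>

definition reachable :: "'v \<Rightarrow> ('v \<times> 'a) set \<Rightarrow> 'v \<Rightarrow> bool" where
  "reachable b E v \<longleftrightarrow> (\<exists>w. edges b w \<subseteq> E \<and> path b w = v)"

lemma reachable_mono: "reachable b E v \<Longrightarrow> E \<subseteq> E' \<Longrightarrow> reachable b E' v"
  by (auto simp: reachable_def)

lemma reachable_path:
  assumes "reachable b E v" "edges v w \<subseteq> E"
  shows "reachable b E (path v w)"
proof -
  obtain u where "edges b u \<subseteq> E" "path b u = v" using assms(1) by (auto simp: reachable_def)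
  then show ?thesis unfolding reachable_def using assms(2) by (intro exI[of _ "u @ w"]) auto
qed

lemma reachable_edges:
  "reachable b E v \<Longrightarrow> edges v w \<subseteq> E \<Longrightarrow> (y, x) \<in> edges v w \<Longrightarrow> reachable b E y"
proof (induction w arbitrary: v)
  case (Cons l w)
  have "reachable b E (act v l)"
    using reachable_path[of b E v "[l]"] Cons.prems by simp
  then show ?case
    using Cons by (auto simp: lift_letter_def split: if_splits)
qed simp

end

section \<open>Subcomplexes of minimal perimeter\<close>

text \<open>Since relators fix every vertex, they lift to closed paths everywhere, and the action
  describes a covering of the presentation complex. \<open>b\<close> is the base vertex, and
  \<open>B\<close> holds the edges that every subcomplex under comparison must contain.\<close>

locale relator_action = letter_action act + presentation X R
  for act :: "'v \<Rightarrow> 'a \<times> bool \<Rightarrow> 'v" and X :: "'a set" and R :: "'a word set" +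
  fixes m :: "'a word \<Rightarrow> nat" and b :: 'v and B :: "('v \<times> 'a) set"
  assumes finite_X: "finite X" and finite_R: "finite R"
    and m_pos: "r \<in> R \<Longrightarrow> m r > 0"
    and matching: "matching_property X R m"
    and path_relator: "r \<in> R \<Longrightarrow> path v r = v"
begin

lemma card_gens_ge: "r \<in> R \<Longrightarrow> m r \<le> card (fst ` set r \<inter> X)"
  using matching unfolding matching_property_def gens_of_def by (drule_tac x = "{r}" in spec) auto

lemma relator_nonempty: "r \<in> R \<Longrightarrow> r \<noteq> []"
  using card_gens_ge[of r] m_pos[of r] by auto

lemma word_power_root_relator: "r \<in> R \<Longrightarrow> word_power (root r) (exponent r) = r"
  by (simp add: word_power_root relator_nonempty)

lemma exponent_relator_pos: "r \<in> R \<Longrightarrow> exponent r > 0"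
  by (simp add: exponent_power relator_nonempty)

text \<open>Every letter of \<open>r\<close> already occurs in its period, so matching for the
  single relator \<open>r\<close> bounds \<open>m r\<close> by the length of one period.
  \<open>attach_cell\<close> needs this when a boundary closes up before \<open>exponent r\<close>
  periods.\<close>

lemma m_le_length_root:
  assumes "r \<in> R"
  shows "m r \<le> length (root r)"
proof -
  have "set (word_power u n) \<subseteq> set u" for u :: "'a word" and n by (induction n) auto
  then have "set r \<subseteq> set (root r)" using word_power_root_relator[OF assms] by metis
  then have "card (fst ` set r \<inter> X) \<le> card (fst ` set (root r))" by (intro card_mono) auto
  also have "\<dots> \<le> length (root r)"
    using card_image_le[of "set (root r)" fst, OF finite_set] card_length[of "root r"] by linarith
  finally show ?thesis using card_gens_ge[OF assms] by linarith
qed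

text \<open>The cycle \<open>c\<close> read from \<open>p\<close> is, up to base point and
  orientation, the lift of \<open>r\<close> at a suitable vertex \<open>v\<close>. The clause on
  \<open>Q\<close> says so for all loop properties at once; the last clause says that what closes up
  at \<open>v\<close> after \<open>j\<close> periods also closes up at \<open>p\<close>.\<close>

lemma relator_cycle:
  assumes "r \<in> R" "c \<in> cyclic_perms r \<union> cyclic_perms (inv_word r)"
  obtains v z where "c = word_power z (exponent r)" "length z = length (root r)"
    "\<And>Q. loop_property Q \<Longrightarrow> Q p c \<longleftrightarrow> Q v r"
    "\<And>j. path v (word_power (root r) j) = v \<Longrightarrow> path p (word_power z j) = p"
proof -
  let ?n = "exponent r"
  have r: "word_power (root r) ?n = r" and n: "?n > 0"
    using assms(1) by (auto simp: word_power_root_relator exponent_relator_pos)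
  have closed: "path v r = v" "path v (inv_word r) = v" for v
    using path_relator[OF assms(1)] by (metis path_inv_word)+
  show ?thesis
  proof (cases "c \<in> cyclic_perms r")
    case True
    then obtain a z where *: "c = word_power z ?n" "length z = length (root r)"
      "\<And>Q v. loop_property Q \<Longrightarrow> Q (path v a) c \<longleftrightarrow> Q v r"
      "\<And>v j. path v (word_power (root r) j) = v \<Longrightarrow> path (path v a) (word_power z j) = path v a"
      using cyclic_perm_word_power[of c "root r" ?n] r n closed by metis
    show ?thesis
    \<comment> \<open>As \<open>a\<close> leads from the start of \<open>r\<close> to the start of
      the rotation, the required vertex is found by going back along \<open>a\<close> from
      \<open>p\<close>.\<close>
    proof (rule that[of z "path p (inv_word a)"])
      show "Q p c \<longleftrightarrow> Q (path p (inv_word a)) r" if "loop_property Q" for Q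
        using *(3)[OF that, of "path p (inv_word a)"] by simp
      show "path p (word_power z j) = p"
        if "path (path p (inv_word a)) (word_power (root r) j) = path p (inv_word a)" for j
        using *(4)[OF that] by simp
    qed (rule *)+
  next
    case False
    have inv: "word_power (inv_word (root r)) ?n = inv_word r"
      using r inv_word_word_power by metis
    with False assms(2) obtain a z where *: "c = word_power z ?n" "length z = length (root r)"
      "\<And>Q v. loop_property Q \<Longrightarrow> Q (path v a) c \<longleftrightarrow> Q v (inv_word r)"
      "\<And>v j. path v (word_power (inv_word (root r)) j) = v \<Longrightarrow>
         path (path v a) (word_power z j) = path v a"
      using cyclic_perm_word_power[of c "inv_word (root r)" ?n] n closed inv_word_simps(4)
      by (metis Un_iff)
    show ?thesis
    proof (rule that[of z "path p (inv_word a)"])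
      show "Q p c \<longleftrightarrow> Q (path p (inv_word a)) r" if "loop_property Q" for Q
        using *(3)[OF that, of "path p (inv_word a)"] loop_property_inv_iff[OF that] closed by simp
      show "path p (word_power z j) = p"
        if "path (path p (inv_word a)) (word_power (root r) j) = path p (inv_word a)" for j
      proof -
        have "path (path p (inv_word a)) (word_power (inv_word (root r)) j) = path p (inv_word a)"
          using that by (metis inv_word_word_power path_inv_word)
        from *(4)[OF this] show ?thesis by simp
      qed
    qed (rule *)+
  qed
qed

text \<open>Starting \<open>r\<close> one period later gives the same cycle with another base
  point.\<close>

lemma loop_property_orbit:
  assumes "loop_property Q" "r \<in> R" "Q v r"
  shows "Q (path v (word_power (root r) j)) r"
proof (induction j)
  case (Suc j)
  let ?u = "root r" and ?v = "path v (word_power (root r) j)"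
  obtain n where n: "exponent r = Suc n" using exponent_relator_pos[OF assms(2)] by (cases "exponent r") auto
  have r: "r = ?u @ word_power ?u n" "r = word_power ?u n @ ?u"
    using word_power_root_relator[OF assms(2)] n word_power_Suc_right[of ?u n] by auto
  have "Q (path ?v ?u) (word_power ?u n @ ?u)"
    using loop_property_rotate[OF assms(1), of ?v ?u "word_power ?u n"] Suc path_relator[OF assms(2), of ?v] r(1)
    by metis
  then show ?case using r(2) word_power_Suc_right[of ?u j] by (metis foldl_append)
qed (use assms in simp)

text \<open>A pair \<open>(v, r)\<close> stands for the lift of the cell of \<open>r\<close> that
  starts at \<open>v\<close>. Lifts whose starting vertices differ by periods of \<open>r\<close>
  have the same boundary cycle; the last condition makes \<open>F\<close> contain them all or
  none.\<close>

definition subcomplex :: "('v \<times> 'a) set \<Rightarrow> ('v \<times> 'a word) set \<Rightarrow> bool" where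
  "subcomplex E F \<longleftrightarrow> finite E \<and> finite F \<and> E \<subseteq> UNIV \<times> X \<and> F \<subseteq> UNIV \<times> R \<and>
     (\<forall>(v, r)\<in>F. edges v r \<subseteq> E \<and> (path v (root r), r) \<in> F)"

definition weight :: "('v \<times> 'a word) set \<Rightarrow> nat" where
  "weight F = (\<Sum>(v, r)\<in>F. m r)"

text \<open>This is \<open>matching_layer_cake\<close> with the number of \<open>r\<close>-cells for
  \<open>a r\<close> and the number of edges over \<open>x\<close> for \<open>e x\<close>. It
  guarantees that the natural subtraction in \<open>perimeter\<close> is never truncated on a
  subcomplex.\<close>

lemma weight_le:
  assumes "subcomplex E F"
  shows "weight F \<le> card E"
proof -
  define cells where "cells r = {v. (v, r) \<in> F}" for r
  define fib where "fib x = {v. (v, x) \<in> E}" for x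
  have F: "F = (\<lambda>(r, v). (v, r)) ` (SIGMA r:R. cells r)"
    using assms by (auto simp: subcomplex_def cells_def)
  have E: "E = (\<lambda>(x, v). (v, x)) ` (SIGMA x:X. fib x)"
    using assms by (auto simp: subcomplex_def fib_def)
  have fin: "finite (cells r)" "finite (fib x)" for r x
  proof -
    have "finite E" "finite F" using assms by (simp_all add: subcomplex_def)
    moreover have "cells r \<subseteq> fst ` F" "fib x \<subseteq> fst ` E"
      unfolding cells_def fib_def by force+
    ultimately show "finite (cells r)" "finite (fib x)" by (simp_all add: finite_subset)
  qed
  have "weight F = (\<Sum>(r, v)\<in>(SIGMA r:R. cells r). m r)"
    unfolding weight_def F
    by (subst sum.reindex) (auto simp: inj_on_def case_prod_unfold)
  also have "\<dots> = (\<Sum>r\<in>R. \<Sum>v\<in>cells r. m r)"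
    by (rule sum.Sigma[symmetric]) (auto simp: finite_R fin)
  also have "\<dots> = (\<Sum>r\<in>R. m r * card (cells r))" by (simp add: mult.commute)
  also have "\<dots> \<le> (\<Sum>x\<in>X. card (fib x))"
  proof (rule matching_layer_cake[OF finite_X finite_R matching])
    fix r x assume "r \<in> R" "x \<in> X" "x \<in> fst ` set r"
    obtain g where g: "inj g" "\<And>v. (g v, x) \<in> edges v r"
      using generator_edge_inj[OF \<open>x \<in> fst ` set r\<close>] by blast
    have "g ` cells r \<subseteq> fib x"
    proof
      fix y assume "y \<in> g ` cells r"
      then obtain v where "(v, r) \<in> F" "y = g v" by (auto simp: cells_def)
      moreover from this have "edges v r \<subseteq> E" using assms by (auto simp: subcomplex_def)
      ultimately show "y \<in> fib x" using g(2)[of v] by (auto simp: fib_def)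
    qed
    moreover have "inj_on g (cells r)" using g(1) by (rule inj_on_subset) simp
    ultimately show "card (cells r) \<le> card (fib x)"
      using fin by (intro card_inj_on_le)
  qed
  also have "\<dots> = card (SIGMA x:X. fib x)"
    using finite_X fin by (simp add: card_SigmaI)
  also have "\<dots> = card E"
    unfolding E by (subst card_image) (auto simp: inj_on_def)
  finally show ?thesis .
qed

definition admissible :: "('v \<times> 'a) set \<Rightarrow> ('v \<times> 'a word) set \<Rightarrow> bool" where
  "admissible E F \<longleftrightarrow> subcomplex E F \<and> B \<subseteq> E \<and> (\<forall>(v, x)\<in>E. reachable b E v)"

definition perimeter :: "('v \<times> 'a) set \<Rightarrow> ('v \<times> 'a word) set \<Rightarrow> nat" where
  "perimeter E F = card E - weight F"

definition minimal :: "('v \<times> 'a) set \<Rightarrow> ('v \<times> 'a word) set \<Rightarrow> bool" where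
  "minimal E F \<longleftrightarrow> admissible E F \<and> (\<forall>E' F'. admissible E' F' \<longrightarrow> perimeter E F \<le> perimeter E' F')"

lemma minimal_exists: "admissible E F \<Longrightarrow> \<exists>E F. minimal E F"
  using ex_has_least_nat[of "\<lambda>(E, F). admissible E F" "(E, F)" "\<lambda>(E, F). perimeter E F"]
  by (auto simp: minimal_def)

text \<open>A labelling of the edges with values in a group \<open>K\<close> that is trivial around
  all cells amounts to a homomorphism from the fundamental groupoid of the subcomplex to
  \<open>K\<close>.\<close>

definition trivial_cells ::
  "('k, 'c) monoid_scheme \<Rightarrow> ('v \<times> 'a \<Rightarrow> 'k) \<Rightarrow> ('v \<times> 'a word) set \<Rightarrow> bool" where
  "trivial_cells K \<phi> F \<longleftrightarrow> (\<forall>(v, r)\<in>F. word_eval K \<phi> (lift_word v r) = \<one>\<^bsub>K\<^esub>)"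

text \<open>The labelling is extended together with the subcomplex and keeps its values on
  \<open>E\<close>, so an identity between old paths that is proved after the attachment held before
  it. Minimality is preserved, so further cells can be attached.\<close>

lemma attach_cell:
  assumes K: "group K" "\<phi> ` E \<subseteq> carrier K"
    and min: "minimal E F" and cells: "trivial_cells K \<phi> F"
    and p: "reachable b E p" "edges p u \<subseteq> E"
    and r: "r \<in> R" "u @ t \<in> cyclic_perms r \<union> cyclic_perms (inv_word r)"
    and short: "length t \<le> exponent r * m r"
  obtains E' F' \<phi>' where "minimal E' F'" "E \<subseteq> E'" "\<phi>' ` E' \<subseteq> carrier K"
    "\<And>e. e \<in> E \<Longrightarrow> \<phi>' e = \<phi> e" "trivial_cells K \<phi>' F'" "null_loop E' K \<phi>' p (u @ t)"
proof -
  interpret K: group K by fact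
  let ?n = "exponent r"
  have adm: "admissible E F" and sub: "subcomplex E F"
    using min by (auto simp: minimal_def admissible_def)
  obtain v z where z: "u @ t = word_power z ?n" "length z = length (root r)"
    and Q: "\<And>Q. loop_property Q \<Longrightarrow> Q p (u @ t) \<longleftrightarrow> Q v r"
    and period: "\<And>j. path v (word_power (root r) j) = v \<Longrightarrow> path p (word_power z j) = p"
    by (rule relator_cycle[OF r, where p = p]) (rule that)
  show ?thesis
  proof (cases "(v, r) \<in> F")
    case True
    then have "null_loop E K \<phi> v r"
      using sub cells by (auto simp: null_loop_def subcomplex_def trivial_cells_def)
    then have "null_loop E K \<phi> p (u @ t)"
      using Q[OF loop_property_null_loop[OF K]] by simp
    then show ?thesis using that[of E F \<phi>, OF min order.refl K(2) HOL.refl cells] by blast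
  next
    case False
    define f where "f = (\<lambda>v. path v (root r))"
    have f: "path v (word_power (root r) j) = (f ^^ j) v" for v j
      by (simp add: f_def path_word_power)
    have root: "word_power (root r) ?n = r" and n: "?n > 0"
      using r(1) by (auto simp: word_power_root_relator exponent_relator_pos)
    have fn: "(f ^^ ?n) v = v" for v
      using f[of v ?n] root path_relator[OF r(1)] by simp
    obtain d where d: "0 < d" "d dvd ?n" "(f ^^ d) v = v" "finite (range (\<lambda>j. (f ^^ j) v))"
      "card (range (\<lambda>j. (f ^^ j) v)) = d"
      by (rule periodic_orbit[OF fn n]) (rule that)
    \<comment> \<open>The orbit of the new cell under the shift by a period. It has to be attached
      as a whole, and its size \<open>d\<close> multiplies the gain in weight.\<close>
    define O' where "O' = (\<lambda>v. (v, r)) ` range (\<lambda>j. (f ^^ j) v)"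
    have finO: "finite O'" using d(4) by (simp add: O'_def)
    have "card O' = d"
      unfolding O'_def using d(5) by (subst card_image) (auto simp: inj_on_def)
    then have weightO: "weight O' = d * m r"
      unfolding weight_def by (subst sum.cong[OF HOL.refl, of _ _ "\<lambda>_. m r"]) (auto simp: O'_def mult.commute)
    have F_iterate: "((f ^^ k) y, r) \<in> F" if "(y, r) \<in> F" for y k
    proof (induction k)
      case (Suc k)
      then show ?case using sub unfolding subcomplex_def f_def by fastforce
    qed (use that in simp)
    \<comment> \<open>\<open>F\<close> is invariant under the shift, and iterating the shift leads
      from any point of the orbit back to \<open>v\<close>. An orbit that met \<open>F\<close> would
      thus bring \<open>(v, r)\<close> into \<open>F\<close>.\<close>
    have disj: "F \<inter> O' = {}"
    proof -
      have "((f ^^ j) v, r) \<notin> F" for j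
      proof
        assume "((f ^^ j) v, r) \<in> F"
        then have "((f ^^ (?n * j - j)) ((f ^^ j) v), r) \<in> F" by (rule F_iterate)
        moreover have "(f ^^ (?n * j - j)) ((f ^^ j) v) = (f ^^ (?n * j)) v"
        proof -
          have "?n * j - j + j = ?n * j" using n by simp
          then show ?thesis using fun_cong[OF funpow_add[of "?n * j - j" j f], of v] by simp
        qed
        moreover have "(f ^^ (?n * j)) v = v"
          using path_word_power_fix[OF path_relator[OF r(1)], of v j] root f[of v "?n * j"]
          by (simp add: word_power_mult)
        ultimately show False using False by simp
      qed
      then show ?thesis by (auto simp: O'_def)
    qed
    define E' where "E' = E \<union> edges p (u @ t)"
    define F' where "F' = F \<union> O'"
    define N where "N = edges (path p u) t - E"
    have over: "edges p (u @ t) \<subseteq> UNIV \<times> X"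
    proof -
      have "word_over X r" "word_over X (inv_word r)" using relators_over[OF r(1)] by simp_all
      moreover have "set (u @ t) = set r \<or> set (u @ t) = set (inv_word r)"
        using r(2) by (auto simp: cyclic_perms_def simp del: set_append)
      ultimately have "word_over X (u @ t)" unfolding word_over_def by metis
      then show ?thesis by (rule edges_over)
    qed
    \<comment> \<open>All cells of the orbit share one boundary cycle, so a loop property checked
      once at \<open>p\<close> holds for each of them.\<close>
    have orbit: "Q y r" if "loop_property Q" "Q p (u @ t)" "(y, r) \<in> O'" for Q y
      using loop_property_orbit[OF that(1) r(1)] Q[OF that(1)] that(2,3) f by (auto simp: O'_def)
    have sub': "subcomplex E' F'"
    proof -
      have "edges y r \<subseteq> E'" if "(y, r) \<in> O'" for y
        using orbit[OF loop_property_edges[of E'] _ that] by (simp add: E'_def)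
      moreover have "(path y (root r), r) \<in> O'" if "(y, r) \<in> O'" for y
      proof -
        obtain j where "y = (f ^^ j) v" using \<open>(y, r) \<in> O'\<close> by (auto simp: O'_def)
        then have "path y (root r) = (f ^^ Suc j) v" by (simp add: f_def)
        then show ?thesis unfolding O'_def by blast
      qed
      ultimately have "\<forall>(y, s)\<in>O'. edges y s \<subseteq> E' \<and> (path y (root s), s) \<in> F'"
        by (auto simp: O'_def F'_def)
      moreover have "\<forall>(y, s)\<in>F. edges y s \<subseteq> E' \<and> (path y (root s), s) \<in> F'"
        using sub by (auto simp: subcomplex_def E'_def F'_def)
      moreover have "O' \<subseteq> UNIV \<times> R" using r(1) by (auto simp: O'_def)
      ultimately show ?thesis
        using sub over finO by (auto simp: subcomplex_def E'_def F'_def)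
    qed
    have "reachable b E' y" if "(y, x) \<in> E'" for y x
    proof (cases "(y, x) \<in> E")
      case True
      then have "reachable b E y" using adm by (auto simp: admissible_def)
      then show ?thesis by (rule reachable_mono) (simp add: E'_def)
    next
      case False
      then have "(y, x) \<in> edges p (u @ t)" using \<open>(y, x) \<in> E'\<close> by (simp add: E'_def)
      moreover have "reachable b E' p" using p(1) by (rule reachable_mono) (simp add: E'_def)
      moreover have "edges p (u @ t) \<subseteq> E'" by (simp add: E'_def)
      ultimately show ?thesis using reachable_edges by blast
    qed
    then have adm': "admissible E' F'"
      using sub' adm by (auto simp: admissible_def E'_def)
    have weight': "weight F' = weight F + d * m r"
      unfolding weightO[symmetric] weight_def F'_def
      by (rule sum.union_disjoint) (use sub finO disj in \<open>auto simp: subcomplex_def\<close>)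
    have card': "card E' = card E + card N"
    proof -
      have "E' = E \<union> N" using p(2) by (auto simp: E'_def N_def)
      moreover have "finite E" "finite N" "E \<inter> N = {}"
        using sub by (auto simp: subcomplex_def N_def)
      ultimately show ?thesis by (simp add: card_Un_disjoint)
    qed
    \<comment> \<open>With fewer new edges, attaching the orbit would lower the perimeter.\<close>
    have N_ge: "d * m r \<le> card N"
    proof -
      have "perimeter E F \<le> perimeter E' F'" using min adm' by (simp add: minimal_def)
      then show ?thesis
        using weight_le[OF sub] weight_le[OF sub'] by (simp add: perimeter_def weight' card')
    qed
    \<comment> \<open>The path already closes up after \<open>d\<close> periods. The whole boundary
      runs \<open>k\<close> times around \<open>c\<close>, so all its edges lie on
      \<open>c\<close>.\<close>
    define c where "c = word_power z d"
    obtain k where k: "?n = d * k" using d(2) by blast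
    have ut: "u @ t = word_power c k" using z(1) k by (simp add: c_def word_power_mult)
    have kpos: "k > 0" using k n by (cases k) auto
    have pc: "path p c = p" unfolding c_def using period[of d] d(3) f by simp
    have edges_ut: "edges p (u @ t) \<subseteq> edges p c" unfolding ut by (rule edges_word_power_subset[OF pc])
    obtain k' where k': "k = Suc k'" using kpos by (cases k) auto
    have ut': "u @ t = c @ word_power c k'" by (simp add: ut k')
    have N_sub: "N \<subseteq> edges p c" using edges_ut by (auto simp: N_def)
    have dm: "d * m r > 0" using d(1) m_pos[OF r(1)] by simp
    \<comment> \<open>If \<open>u\<close> ran once around \<open>c\<close>, the whole boundary would
      lie in \<open>E\<close> and \<open>N\<close> would be empty.\<close>
    have prefix: "length u < length c"
    proof (rule ccontr)
      assume "\<not> length u < length c"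
      moreover have "take (length c) (u @ t) = c" by (simp add: ut')
      ultimately have "take (length c) u = c" by simp
      then have "edges p c \<subseteq> edges p u"
        by (metis append_take_drop_id edges_simps(3) Un_upper1)
      then have "N = {}" using N_sub p(2) by (auto simp: N_def)
      then show False using N_ge dm by simp
    qed
    \<comment> \<open>The part of a single turn that \<open>u\<close> leaves over; every new edge
      lies on it.\<close>
    define s where "s = drop (length u) c"
    have c: "c = u @ s"
    proof -
      have "take (length u) (c @ word_power c k') = u" by (simp flip: ut')
      then have "take (length u) c = u" using prefix by simp
      then show ?thesis unfolding s_def by (metis append_take_drop_id)
    qed
    have N_s: "N \<subseteq> edges (path p u) s - E"
      using N_sub p(2) by (auto simp: N_def c)
    \<comment> \<open>\<open>s\<close> is shorter than \<open>t\<close> by \<open>?n - d\<close>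
      periods, each of length at least \<open>m r\<close>. Taking these from the bound
      \<open>?n * m r\<close> on \<open>t\<close> leaves \<open>d * m r\<close>. The excess
      \<open>q\<close> of a period over \<open>m r\<close> keeps the arithmetic free of
      subtraction.\<close>
    have len_s: "length s \<le> d * m r"
    proof -
      let ?L = "length (root r)"
      obtain q where q: "?L = m r + q" using m_le_length_root[OF r(1)] le_Suc_ex by blast
      have "length u + length t = ?n * ?L" using arg_cong[OF z(1), of length] z(2) by simp
      then have "length u + length t = ?n * m r + ?n * q" by (simp add: q distrib_left)
      moreover have "length u + length s = d * ?L"
        using arg_cong[OF c, of length] z(2) by (simp add: c_def)
      then have "length u + length s = d * m r + d * q" by (simp add: q distrib_left)
      moreover have "d * q \<le> ?n * q" using d(2) n by (intro mult_le_mono1) (simp add: dvd_imp_le)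
      ultimately show ?thesis using short by linarith
    qed
    let ?es = "map fst (lift_word (path p u) s)"
    have es: "set ?es = edges (path p u) s" by (simp add: edges_def)
    have "card N \<le> card (edges (path p u) s - E)" by (intro card_mono N_s) simp
    then have len: "length ?es \<le> card (set ?es - E)"
      using N_ge len_s es by simp
    \<comment> \<open>The upper and the lower bound meet: the path \<open>s\<close> traverses
      pairwise distinct edges, none of them in \<open>E\<close>.\<close>
    note distinct = card_set_diff_ge_length[OF len]
    have "card N \<le> length s"
      using \<open>card N \<le> card (edges (path p u) s - E)\<close> card_mono[of "set ?es" "set ?es - E"]
        card_length[of ?es] es by simp
    then have "card N \<le> d * m r" using len_s by simp
    then have "perimeter E' F' \<le> perimeter E F" by (simp add: perimeter_def weight' card')
    with min adm' have min': "minimal E' F'"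
      unfolding minimal_def by (meson order_trans)
    have "s \<noteq> []" using N_ge dm \<open>card N \<le> length s\<close> by auto
    then obtain l s' where s: "s = l # s'" by (cases s) auto
    obtain e \<sigma> where e: "lift_letter (path p u) l = (e, \<sigma>)" by (cases "lift_letter (path p u) l")
    define g where "g = inv\<^bsub>K\<^esub> word_eval K \<phi> (lift_word p u)"
    have ucl: "word_eval K \<phi> (lift_word p u) \<in> carrier K" by (rule word_eval_lift_closed[OF K p(2)])
    then have g: "g \<in> carrier K" by (simp add: g_def)
    txt \<open>The new edges carry exactly one relation, the boundary of the new cell, which is solved
      for the first of them.\<close>
    define \<psi> where "\<psi> x = (if x \<in> E then \<phi> x else if x = e then (if \<sigma> then g else inv\<^bsub>K\<^esub> g) else \<one>\<^bsub>K\<^esub>)" for x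
    have \<psi>E: "\<And>x. x \<in> E \<Longrightarrow> \<psi> x = \<phi> x" by (simp add: \<psi>_def)
    have \<psi>cl: "\<psi> ` A \<subseteq> carrier K" for A
      using K(2) g by (auto simp: \<psi>_def)
    have "e \<notin> E" using distinct(2) s e by auto
    then have "letter_eval K \<psi> (e, \<sigma>) = g" using g by (simp add: letter_eval_def \<psi>_def)
    \<comment> \<open>The remaining edges of \<open>s\<close> are new and different from
      \<open>e\<close>, so \<open>\<psi>\<close> takes its default value one on them.\<close>
    moreover have "word_eval K \<psi> (lift_word (act (path p u) l) s') = \<one>\<^bsub>K\<^esub>"
    proof (rule K.word_eval_trivial, rule ballI)
      fix x assume "x \<in> fst ` set (lift_word (act (path p u) l) s')"
      then show "\<psi> x = \<one>\<^bsub>K\<^esub>" using distinct s e by (auto simp: \<psi>_def)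
    qed
    ultimately have "word_eval K \<psi> (lift_word (path p u) s) = g" using g by (simp add: s e)
    moreover have "word_eval K \<psi> (lift_word p u) = word_eval K \<phi> (lift_word p u)"
      by (rule word_eval_lift_cong[OF K(1) p(2) \<psi>E])
    ultimately have c1: "word_eval K \<psi> (lift_word p c) = \<one>\<^bsub>K\<^esub>"
      unfolding c using word_eval_lift_append[OF K(1) \<psi>cl subset_UNIV, of p u s] ucl by (simp add: g_def)
    have "word_eval K \<psi> (lift_word p (word_power c j)) = \<one>\<^bsub>K\<^esub>" for j
    proof (induction j)
      case (Suc j)
      then show ?case
        using word_eval_lift_append[OF K(1) \<psi>cl subset_UNIV, of p c "word_power c j"] c1 pc by simp
    qed simp
    then have null: "null_loop E' K \<psi> p (u @ t)"
      unfolding null_loop_def ut[symmetric] by (metis E'_def Un_upper2 ut)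
    have "trivial_cells K \<psi> O'"
    proof -
      have "null_loop E' K \<psi> y r" if "(y, r) \<in> O'" for y
        using orbit[OF loop_property_null_loop[OF K(1) \<psi>cl] null that] .
      then show ?thesis by (auto simp: trivial_cells_def null_loop_def O'_def)
    qed
    moreover have "trivial_cells K \<psi> F"
    proof -
      have "word_eval K \<psi> (lift_word y q) = \<one>\<^bsub>K\<^esub>" if "(y, q) \<in> F" for y q
      proof -
        have "edges y q \<subseteq> E" "word_eval K \<phi> (lift_word y q) = \<one>\<^bsub>K\<^esub>"
          using that sub cells by (auto simp: subcomplex_def trivial_cells_def)
        then show ?thesis using word_eval_lift_cong[OF K(1) _ \<psi>E] by simp
      qed
      then show ?thesis by (auto simp: trivial_cells_def)
    qed
    ultimately have "trivial_cells K \<psi> F'" by (auto simp: trivial_cells_def F'_def)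
    with that[OF min' _ \<psi>cl \<psi>E _ null] show ?thesis by (simp add: E'_def)
  qed
qed

text \<open>Being closed is itself a loop property, so \<open>relator_cycle\<close> reduces this to
  \<open>path_relator\<close>.\<close>

lemma path_relator_cycle:
  assumes "r \<in> R" "c \<in> cyclic_perms r \<union> cyclic_perms (inv_word r)"
  shows "path p c = p"
proof (rule relator_cycle[OF assms, where p = p])
  have "loop_property (\<lambda>v q. path v q = v)"
    unfolding loop_property_def by (metis foldl_append path_inv_word)
  moreover fix v assume "\<And>Q. loop_property Q \<Longrightarrow> Q p c = Q v r"
  ultimately show ?thesis using path_relator[OF assms(1), of v] by blast
qed

text \<open>The induction hypothesis \<open>step\<close> ranges over all base points and all minimal
  subcomplexes with a labelling, because a cyclic reduction moves the base point and a replacement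
  may enlarge the subcomplex.\<close>

lemma move_trivial_loop:
  assumes "move R m w w'" and K: "group K" "\<phi> ` E \<subseteq> carrier K"
    and min: "minimal E F" and cells: "trivial_cells K \<phi> F"
    and v: "reachable b E v" "edges v w \<subseteq> E" "path v w = v"
    and step: "\<And>v E F \<phi>. minimal E F \<Longrightarrow> \<phi> ` E \<subseteq> carrier K \<Longrightarrow> trivial_cells K \<phi> F \<Longrightarrow>
      reachable b E v \<Longrightarrow> edges v w' \<subseteq> E \<Longrightarrow> path v w' = v \<Longrightarrow>
      word_eval K \<phi> (lift_word v w') = \<one>\<^bsub>K\<^esub>"
  shows "word_eval K \<phi> (lift_word v w) = \<one>\<^bsub>K\<^esub>"
proof -
  interpret K: group K by fact
  note append = word_eval_lift_append[OF K] and closed = word_eval_lift_closed[OF K]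
  show ?thesis
    using assms(1)
  proof cases
    case (free_red p l q)
    let ?y = "path v p"
    have sub: "edges v p \<subseteq> E" "edges ?y q \<subseteq> E" "fst (lift_letter ?y l) \<in> E" "edges v (p @ q) \<subseteq> E"
      using v(2) free_red by auto
    have "word_eval K \<phi> (lift_word v w) = word_eval K \<phi> (lift_word v p) \<otimes>\<^bsub>K\<^esub>
        word_eval K \<phi> (lift_word ?y ([l, inv_letter l] @ q))"
      using append[of v p "[l, inv_letter l] @ q"] v(2) free_red(1) by simp
    also have "word_eval K \<phi> (lift_word ?y ([l, inv_letter l] @ q)) = word_eval K \<phi> (lift_word ?y q)"
      using K.letter_eval_closed[OF K(2) sub(3)] closed[OF sub(2)] K.letter_eval_inv[OF K(2) sub(3)]
      by (simp add: lift_letter_inv K.cancel_left)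
    also have "word_eval K \<phi> (lift_word v p) \<otimes>\<^bsub>K\<^esub> word_eval K \<phi> (lift_word ?y q) =
        word_eval K \<phi> (lift_word v w')"
      using append[OF sub(4)] free_red(2) by simp
    also have "\<dots> = \<one>\<^bsub>K\<^esub>"
      using step[OF min K(2) cells v(1)] sub(4) v(3) free_red by simp
    finally show ?thesis .
  next
    case (cyc_free_red l)
    \<comment> \<open>Dropping the outer letters moves the base point to \<open>?y\<close> and only
      conjugates the value.\<close>
    let ?y = "act v l"
    have "act (path ?y w') (inv_letter l) = v" using v(3) cyc_free_red by simp
    then have y: "path ?y w' = ?y" by (metis act_inv_letter')
    have L: "fst (lift_letter v l) \<in> E" and sub: "edges ?y w' \<subseteq> E"
      and sub2: "edges ?y (w' @ [inv_letter l]) \<subseteq> E"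
      using v(2) cyc_free_red by auto
    have "reachable b E ?y"
      using reachable_path[OF v(1), of "[l]"] L by simp
    then have 1: "word_eval K \<phi> (lift_word ?y w') = \<one>\<^bsub>K\<^esub>"
      using step[OF min K(2) cells _ sub y] by simp
    have "word_eval K \<phi> (lift_word ?y (w' @ [inv_letter l])) = inv\<^bsub>K\<^esub> letter_eval K \<phi> (lift_letter v l)"
      using append[OF sub2] 1 K.letter_eval_closed[OF K(2) L] K.letter_eval_inv[OF K(2) L] y
      by (simp add: lift_letter_inv)
    then show ?thesis
      using cyc_free_red K.letter_eval_closed[OF K(2) L] by simp
  next
    case (complement r u t p q)
    let ?y = "path v p"
    have reach: "reachable b E ?y" and u: "edges ?y u \<subseteq> E"
      using v(2) complement reachable_path[OF v(1), of p] by auto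
    have short: "length t \<le> exponent r * m r" using complement(5) by simp
    \<comment> \<open>The lift of \<open>w'\<close> may leave \<open>E\<close>. After attaching the
      cell, \<open>u\<close> and its complement have the same value under \<open>\<phi>'\<close>,
      hence so do \<open>w\<close> and \<open>w'\<close>; on the original loop
      \<open>\<phi>'\<close> still agrees with \<open>\<phi>\<close>.\<close>
    obtain E' F' \<phi>' where new: "minimal E' F'" "E \<subseteq> E'" "\<phi>' ` E' \<subseteq> carrier K"
      "\<And>e. e \<in> E \<Longrightarrow> \<phi>' e = \<phi> e" "trivial_cells K \<phi>' F'" "null_loop E' K \<phi>' ?y (u @ t)"
      by (rule attach_cell[OF K min cells reach u complement(3,4) short]) (rule that)
    note append' = word_eval_lift_append[OF K(1) new(3)] and closed' = word_eval_lift_closed[OF K(1) new(3)]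
    have yc: "path ?y (u @ t) = ?y" by (rule path_relator_cycle[OF complement(3,4)])
    then have t: "path ?y (inv_word t) = path ?y u"
      by (metis foldl_append path_inv_word)
    have ut: "edges ?y (u @ t) \<subseteq> E'" using new(6) by (simp add: null_loop_def)
    have t_edges: "edges ?y (inv_word t) = edges (path ?y u) t"
      using edges_inv[of "path ?y u" t] yc by simp
    have "word_eval K \<phi>' (lift_word ?y u) \<otimes>\<^bsub>K\<^esub> word_eval K \<phi>' (lift_word (path ?y u) t) = \<one>\<^bsub>K\<^esub>"
      using append'[OF ut] new(6) by (simp add: null_loop_def)
    then have "word_eval K \<phi>' (lift_word ?y u) = inv\<^bsub>K\<^esub> word_eval K \<phi>' (lift_word (path ?y u) t)"
      using closed' ut by (intro K.inv_equality[symmetric]) auto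
    also have "\<dots> = word_eval K \<phi>' (lift_word ?y (inv_word t))"
      using word_eval_lift_inv[OF K(1) new(3), of "path ?y u" t] ut yc by simp
    finally have same: "word_eval K \<phi>' (lift_word ?y u) = word_eval K \<phi>' (lift_word ?y (inv_word t))" .
    have old: "edges v (p @ u @ q) \<subseteq> E'" using v(2) new(2) complement(1) by auto
    moreover have "edges v (p @ inv_word t @ q) \<subseteq> E'" using old ut t t_edges by auto
    ultimately have eq: "word_eval K \<phi>' (lift_word v w) = word_eval K \<phi>' (lift_word v w')"
      unfolding complement(1,2) using append' same t by (simp del: lift_word_append)
    have "word_eval K \<phi> (lift_word v w) = word_eval K \<phi>' (lift_word v w)"
      by (rule word_eval_lift_cong[OF K(1) v(2) new(4), symmetric])
    also have "\<dots> = \<one>\<^bsub>K\<^esub>"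
    proof -
      have "reachable b E' v" using v(1) new(2) by (rule reachable_mono)
      moreover have "path v w' = v" using v(3) complement t by simp
      ultimately show ?thesis
        unfolding eq using step[OF new(1,3,5)] \<open>edges v (p @ inv_word t @ q) \<subseteq> E'\<close> complement(2) by simp
    qed
    finally show ?thesis .
  qed
qed

lemma reducible_loop_trivial:
  assumes K: "group K" and "(move R m)\<^sup>*\<^sup>* w []"
    and "minimal E F" "\<phi> ` E \<subseteq> carrier K" "trivial_cells K \<phi> F"
    and "reachable b E v" "edges v w \<subseteq> E" "path v w = v"
  shows "word_eval K \<phi> (lift_word v w) = \<one>\<^bsub>K\<^esub>"
  using assms(2-)
proof (induction arbitrary: v E F \<phi> rule: converse_rtranclp_induct)
  case (step w w')
  show ?case
    by (rule move_trivial_loop[OF step.hyps(1) K step.prems(2,1,3-6)]) (rule step.IH)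
qed simp

section \<open>Stabilizers\<close>

text \<open>The generators are the edges of a minimal subcomplex. The relators are the boundaries of
  its cells and one connecting path from \<open>b\<close> to each vertex, which do the work of a
  spanning tree. Containing \<open>B\<close> makes the edges generate \<open>H\<close>; minimality
  makes the relators suffice.\<close>

lemma stabilizer_finitely_presented:
  assumes H: "subgroup H P"
    and stab: "\<And>w. word_over X w \<Longrightarrow> path b w = b \<longleftrightarrow> cls w \<in> H"
    and reducible: "\<And>w. word_over X w \<Longrightarrow> (w, []) \<in> pres_rel X R \<Longrightarrow> (move R m)\<^sup>*\<^sup>* w []"
    and A: "finite A" "A \<subseteq> carrier P" "H = generate P A"
    and wd: "\<And>a. a \<in> A \<Longrightarrow> word_over X (wd a) \<and> cls (wd a) = a"
    and B: "B = (\<Union>a\<in>A. edges b (wd a))"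
  shows "finitely_presented (P\<lparr>carrier := H\<rparr>)"
proof -
  interpret P: group P by (rule group_pres_group)
  have "subcomplex B {}"
  proof -
    have "edges b (wd a) \<subseteq> UNIV \<times> X" if "a \<in> A" for a using wd[OF that] by (intro edges_over) simp
    then have "B \<subseteq> UNIV \<times> X" unfolding B by blast
    moreover have "finite B" using A(1) by (simp add: B)
    ultimately show ?thesis by (simp add: subcomplex_def)
  qed
  moreover have "reachable b B v" if vx: "(v, x) \<in> B" for v x
  proof -
    obtain a where a: "a \<in> A" "(v, x) \<in> edges b (wd a)" using vx by (auto simp: B)
    have "reachable b B b" unfolding reachable_def by (rule exI[of _ "[]"]) simp
    moreover have "edges b (wd a) \<subseteq> B" using a(1) by (auto simp: B)
    ultimately show ?thesis using a(2) by (rule reachable_edges)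
  qed
  ultimately have "admissible B {}" by (auto simp: admissible_def)
  then obtain E F where min: "minimal E F" using minimal_exists by blast
  have sub: "subcomplex E F" and BE: "B \<subseteq> E" and reach: "\<And>v x. (v, x) \<in> E \<Longrightarrow> reachable b E v"
    using min by (auto simp: minimal_def admissible_def)
  have over: "word_over X w" if "edges v w \<subseteq> E" for v w
    using that sub by (intro word_over_edges[of v]) (auto simp: subcomplex_def)
  \<comment> \<open>The vertices of the subcomplex: reachability supplies connecting paths, and the
    incidence clause makes finiteness visible.\<close>
  define V where "V = {v. reachable b E v \<and> (v = b \<or> (\<exists>x. (v, x) \<in> E) \<or> (\<exists>v' x. (v', x) \<in> E \<and> v = act v' (x, True)))}"
  have bV: "b \<in> V"
    unfolding V_def reachable_def by (auto intro: exI[of _ "[]"])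
  have "V \<subseteq> insert b (fst ` E \<union> (\<lambda>(v, x). act v (x, True)) ` E)"
    by (force simp: V_def)
  then have finV: "finite V"
    by (rule finite_subset) (use sub in \<open>simp add: subcomplex_def\<close>)
  have EV: "v \<in> V" "act v (x, True) \<in> V" if "(v, x) \<in> E" for v x
    using that reach[OF that] reachable_path[OF reach[OF that], of "[(x, True)]"]
    by (auto simp: V_def lift_letter_def)
  have letterV: "v \<in> V \<and> act v l \<in> V" if "fst (lift_letter v l) \<in> E" for v l
  proof (cases l)
    case (Pair x s)
    have "act (act v (x, False)) (x, True) = v"
      using act_inv_letter[of v "(x, False)"] by (simp add: inv_letter_def)
    then show ?thesis
      using that EV[of v x] EV[of "act v (x, False)" x] Pair
      by (cases s) (auto simp: lift_letter_def)
  qed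
  \<comment> \<open>The connecting path at \<open>b\<close> itself is empty, so that a loop at
    \<open>b\<close> will evaluate to its own class.\<close>
  define T where "T v = (if v = b then [] else SOME w. edges b w \<subseteq> E \<and> path b w = v)" for v
  have T: "edges b (T v) \<subseteq> E" "path b (T v) = v" if "v \<in> V" for v
  proof -
    have "\<exists>w. edges b w \<subseteq> E \<and> path b w = v" using that by (simp add: V_def reachable_def)
    from someI_ex[OF this] show "edges b (T v) \<subseteq> E" "path b (T v) = v" by (simp_all add: T_def)
  qed
  have TX: "word_over X (T v)" if "v \<in> V" for v using over[OF T(1)[OF that]] .
  \<comment> \<open>An edge becomes a loop at \<open>b\<close>: out along a connecting path, across
    the edge and back along the connecting path of its end.\<close>
  define \<epsilon> where "\<epsilon> e = cls (T (fst e) @ (snd e, True) # inv_word (T (act (fst e) (snd e, True))))" for e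
  have EX: "x \<in> X" if "(v, x) \<in> E" for v x using that sub by (auto simp: subcomplex_def)
  have \<epsilon>H: "\<epsilon> ` E \<subseteq> H"
  proof
    fix h assume "h \<in> \<epsilon> ` E"
    then obtain v x where e: "(v, x) \<in> E" "h = \<epsilon> (v, x)" by auto
    let ?v' = "act v (x, True)"
    have v: "v \<in> V" "?v' \<in> V" using EV[OF e(1)] by auto
    have "path ?v' (inv_word (T ?v')) = b" using path_inv_word[of b "T ?v'"] T(2)[OF v(2)] by simp
    then have "path b (T v @ (x, True) # inv_word (T ?v')) = b" using T(2)[OF v(1)] by simp
    then show "h \<in> H"
      using stab[of "T v @ (x, True) # inv_word (T ?v')"] TX[OF v(1)] TX[OF v(2)] EX[OF e(1)] e(2)
      by (simp add: \<epsilon>_def)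
  qed
  have HP: "H \<subseteq> carrier P" using H by (rule subgroup.subset)
  then have \<epsilon>P: "\<epsilon> ` E \<subseteq> carrier P" using \<epsilon>H by blast
  have letter: "letter_eval P \<epsilon> (lift_letter v l) = cls (T v @ l # inv_word (T (act v l)))"
    if l: "fst (lift_letter v l) \<in> E" for v l
  proof (cases l)
    case (Pair x s)
    show ?thesis
    proof (cases s)
      case True
      then show ?thesis using Pair by (simp add: lift_letter_def letter_eval_def \<epsilon>_def)
    next
      case False
      have "act (act v l) (x, True) = v"
        using act_inv_letter[of v l] Pair False by (simp add: inv_letter_def)
      moreover have "word_over X (T (act v l) @ (x, True) # inv_word (T v))"
        using letterV[OF l] TX EX[of "act v l" x] l Pair False by (auto simp: lift_letter_def)
      ultimately show ?thesis
        using Pair False cls_inv_word[of "T (act v l) @ (x, True) # inv_word (T v)"]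
        by (simp add: lift_letter_def letter_eval_def \<epsilon>_def inv_letter_def)
    qed
  qed
  \<comment> \<open>The product telescopes: the connecting paths at intermediate vertices
    cancel.\<close>
  have eval: "path v w \<in> V \<and> word_eval P \<epsilon> (lift_word v w) = cls (T v @ w @ inv_word (T (path v w)))"
    if "v \<in> V" "edges v w \<subseteq> E" for v w
    using that
  proof (induction w arbitrary: v)
    case Nil
    then show ?case using TX by (simp add: cls_append cls_inv_word)
  next
    case (Cons l w)
    let ?y = "act v l"
    have l: "fst (lift_letter v l) \<in> E" and w: "edges ?y w \<subseteq> E" using Cons.prems by auto
    have y: "?y \<in> V" using letterV[OF l] by blast
    note IH = Cons.IH[OF y w]
    have ov: "word_over X [l]" "word_over X w" "word_over X (T v)" "word_over X (T ?y)" "word_over X (T (path ?y w))"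
      using over[OF Cons.prems(2)] TX Cons.prems(1) y IH by simp_all
    have "word_eval P \<epsilon> (lift_word v (l # w)) =
        cls (T v @ [l] @ inv_word (T ?y)) \<otimes>\<^bsub>P\<^esub> cls (T ?y @ w @ inv_word (T (path ?y w)))"
      using letter[OF l] IH by simp
    also have "\<dots> = cls (T v @ [l] @ w @ inv_word (T (path ?y w)))"
    proof -
      let ?z = "T (path ?y w)"
      have "cls (T v @ [l] @ inv_word (T ?y)) = cls (T v) \<otimes>\<^bsub>P\<^esub> (cls [l] \<otimes>\<^bsub>P\<^esub> inv\<^bsub>P\<^esub> cls (T ?y))"
        "cls (T ?y @ w @ inv_word ?z) = cls (T ?y) \<otimes>\<^bsub>P\<^esub> (cls w \<otimes>\<^bsub>P\<^esub> inv\<^bsub>P\<^esub> cls ?z)"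
        "cls (T v @ [l] @ w @ inv_word ?z) =
          cls (T v) \<otimes>\<^bsub>P\<^esub> (cls [l] \<otimes>\<^bsub>P\<^esub> (cls w \<otimes>\<^bsub>P\<^esub> inv\<^bsub>P\<^esub> cls ?z))"
        using ov cls_append[of "[l]" "inv_word (T ?y)"] cls_append[of "[l]" "w @ inv_word ?z"]
        by (simp_all add: cls_append cls_inv_word)
      moreover have "inv\<^bsub>P\<^esub> cls (T ?y) \<otimes>\<^bsub>P\<^esub> (cls (T ?y) \<otimes>\<^bsub>P\<^esub> y) = y" if "y \<in> carrier P" for y
        using ov that by (simp add: P.m_assoc[symmetric])
      ultimately show ?thesis using ov by (simp add: P.m_assoc del: append_Cons)
    qed
    finally show ?case using IH by simp
  qed
  have Tb: "T b = []" by (simp add: T_def)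
  \<comment> \<open>Each connecting path is killed as a whole word, so the paths may be chosen
    independently of each other.\<close>
  define S where "S = (\<lambda>v. lift_word b (T v)) ` V \<union> (\<lambda>(v, r). lift_word v r) ` F"
  have FV: "v \<in> V \<and> edges v r \<subseteq> E \<and> r \<in> R" if "(v, r) \<in> F" for v r
  proof -
    have vr: "edges v r \<subseteq> E" "r \<in> R" using that sub by (auto simp: subcomplex_def)
    then obtain l r' where "r = l # r'" using relator_nonempty by (cases r) auto
    then show ?thesis using vr letterV[of v l] by auto
  qed
  let ?H = "P\<lparr>carrier := H\<rparr>"
  have H_eval: "word_eval ?H \<epsilon> w = word_eval P \<epsilon> w" if "word_over E w" for w
    by (rule P.word_eval_subgroup[OF H \<epsilon>H that])
  have S_over: "word_over E s" if "s \<in> S" for s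
    using that T(1) FV by (auto simp: S_def word_over_lift_word)
  have S_eval: "word_eval P \<epsilon> s = \<one>\<^bsub>P\<^esub>" if "s \<in> S" for s
  proof -
    consider v where "v \<in> V" "s = lift_word b (T v)" | v r where "(v, r) \<in> F" "s = lift_word v r"
      using \<open>s \<in> S\<close> by (auto simp: S_def)
    then show ?thesis
    proof cases
      case 1
      then show ?thesis
        using eval[OF bV T(1)[OF 1(1)]] T(2)[OF 1(1)] Tb TX[OF 1(1)] pres_rel_inv_right[of "T v"]
        by (simp add: one_pres_group cls_eq_iff)
    next
      case 2
      then have v: "v \<in> V" "edges v r \<subseteq> E" "r \<in> R" using FV by auto
      then show ?thesis
        using eval[OF v(1,2)] path_relator[OF v(3)] TX[OF v(1)] relators_over[OF v(3)] 2(2)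
        by (simp add: cls_append cls_relator cls_inv_word)
    qed
  qed
  have surj: "\<exists>w. word_over E w \<and> word_eval P \<epsilon> w = h" if "h \<in> H" for h
  proof -
    have gen: "\<exists>w. word_over E w \<and> word_eval P \<epsilon> w = a" if "a \<in> A" for a
    proof (intro exI[of _ "lift_word b (wd a)"] conjI)
      have e: "edges b (wd a) \<subseteq> E" using that BE by (auto simp: B)
      then show "word_over E (lift_word b (wd a))" by (simp add: word_over_lift_word)
      have "a \<in> H" using that A(3) generate.incl by metis
      then have "path b (wd a) = b" using stab[of "wd a"] wd[OF that] by simp
      then show "word_eval P \<epsilon> (lift_word b (wd a)) = a"
        using eval[OF bV e] wd[OF that] Tb by simp
    qed
    have "h \<in> generate P A" using that A(3) by simp
    then show ?thesis
    proof induction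
      case one
      show ?case by (intro exI[of _ "[]"]) simp
    next
      case (incl a)
      then show ?case by (rule gen)
    next
      case (inv a)
      then obtain w where "word_over E w" "word_eval P \<epsilon> w = a" using gen by blast
      then show ?case using P.word_eval_inv_word[OF \<epsilon>P] by (intro exI[of _ "inv_word w"]) simp
    next
      case (eng h1 h2)
      then obtain w1 w2 where "word_over E w1" "word_eval P \<epsilon> w1 = h1" "word_over E w2" "word_eval P \<epsilon> w2 = h2"
        by blast
      then show ?case using P.word_eval_append[OF \<epsilon>P] by (intro exI[of _ "w1 @ w2"]) simp
    qed
  qed
  \<comment> \<open>The tautological labelling of edges by the generators of this group is the one
    to which the results on minimal subcomplexes are applied: a value of one there is derivability
    from \<open>S\<close>.\<close>
  interpret Q: presentation E S by unfold_locales (rule S_over)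
  interpret K: group Q.P by (rule Q.group_pres_group)
  let ?K = "\<lambda>w. word_eval Q.P Q.gen w"
  have S_K: "?K s = \<one>\<^bsub>Q.P\<^esub>" if "s \<in> S" for s
    using Q.word_eval_gen[OF S_over[OF that]] Q.cls_relator[OF that] by simp
  note K = Q.group_pres_group Q.gen_closed
  \<comment> \<open>Connecting paths are trivial in \<open>Q.P\<close>, so there an edge has the
    same value as the loop at \<open>b\<close> that runs through it. Arbitrary words in the edges
    can thereby be replaced by honest loops.\<close>
  have loop_letter: "\<exists>w. edges b w \<subseteq> E \<and> path b w = b \<and> cls w = letter_eval P \<epsilon> L \<and>
      ?K (lift_word b w) = letter_eval Q.P Q.gen L" if L: "fst L \<in> E" for L
  proof -
    obtain v x s where Ls: "L = ((v, x), s)" by (metis surj_pair)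
    let ?y = "act v (x, True)"
    let ?w = "T v @ (x, True) # inv_word (T ?y)"
    have e: "(v, x) \<in> E" using L Ls by simp
    have v: "v \<in> V" "?y \<in> V" using EV[OF e] by auto
    have lift: "lift_word b ?w = lift_word b (T v) @ ((v, x), True) # inv_word (lift_word b (T ?y))"
      using T(2)[OF v(1)] T(2)[OF v(2)] lift_word_inv[of b "T ?y"] by (simp add: lift_letter_def)
    have "edges b ?w \<subseteq> E" "path b ?w = b"
      using T[OF v(1)] T[OF v(2)] path_inv_word[of b "T ?y"] edges_inv[of b "T ?y"] e
      by (simp_all add: lift_letter_def)
    have clsw: "cls ?w = \<epsilon> (v, x)" by (simp add: \<epsilon>_def)
    have "?K (lift_word b (T v)) = \<one>\<^bsub>Q.P\<^esub>" "?K (lift_word b (T ?y)) = \<one>\<^bsub>Q.P\<^esub>"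
      using S_K v by (auto simp: S_def)
    moreover have o: "word_over E (lift_word b (T v))" "word_over E (lift_word b (T ?y))"
      using T(1) v by (simp_all add: word_over_lift_word)
    ultimately have Kw: "?K (lift_word b ?w) = Q.gen (v, x)"
      unfolding lift
      using K.word_eval_append[OF K(2) o(1), of "((v, x), True) # inv_word (lift_word b (T ?y))"]
        K.word_eval_inv_word[OF K(2) o(2)] e
      by (simp add: letter_eval_def)
    obtain w where w: "edges b w \<subseteq> E" "path b w = b" "cls w = \<epsilon> (v, x)" "?K (lift_word b w) = Q.gen (v, x)"
      using \<open>edges b ?w \<subseteq> E\<close> \<open>path b ?w = b\<close> clsw Kw by blast
    show ?thesis
    proof (cases s)
      case True
      then show ?thesis using w Ls by (intro exI[of _ w]) (simp add: letter_eval_def)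
    next
      case False
      have "path b (inv_word w) = b" "edges b (inv_word w) = edges b w"
        "?K (lift_word b (inv_word w)) = inv\<^bsub>Q.P\<^esub> ?K (lift_word b w)"
        using path_inv_word[of b w] edges_inv[of b w] word_eval_lift_inv[OF K w(1)] w(2) by simp_all
      then show ?thesis
        using w Ls False cls_inv_word[OF over[OF w(1)]]
        by (intro exI[of _ "inv_word w"]) (simp add: letter_eval_def)
    qed
  qed
  have loop: "\<exists>w. edges b w \<subseteq> E \<and> path b w = b \<and> cls w = word_eval P \<epsilon> W \<and>
      ?K (lift_word b w) = ?K W" if "word_over E W" for W
    using that
  proof (induction W)
    case Nil
    show ?case by (intro exI[of _ "[]"]) (simp add: one_pres_group)
  next
    case (Cons L W)
    then obtain w where w: "edges b w \<subseteq> E" "path b w = b" "cls w = word_eval P \<epsilon> W" "?K (lift_word b w) = ?K W"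
      by auto
    obtain u where u: "edges b u \<subseteq> E" "path b u = b" "cls u = letter_eval P \<epsilon> L"
      "?K (lift_word b u) = letter_eval Q.P Q.gen L"
      using loop_letter[of L] Cons.prems by auto
    have "?K (lift_word b (u @ w)) = ?K (L # W)"
      using word_eval_lift_append[OF K, of b u w] u w by simp
    moreover have "cls (u @ w) = word_eval P \<epsilon> (L # W)"
      using cls_append[OF over[OF u(1)] over[OF w(1)]] u w by simp
    ultimately show ?case using u w by (intro exI[of _ "u @ w"]) (simp del: lift_word_append word_eval.simps)
  qed
  have cells: "trivial_cells Q.P Q.gen F"
    using S_K by (auto simp: trivial_cells_def S_def)
  \<comment> \<open>A loop \<open>w\<close> with the values of \<open>W\<close> represents one in
    \<open>P\<close>, so the moves reduce it to the empty word, and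
    \<open>reducible_loop_trivial\<close> makes it trivial in \<open>Q.P\<close>.\<close>
  have ker: "(W, []) \<in> pres_rel E S" if W: "word_over E W" "word_eval P \<epsilon> W = \<one>\<^bsub>P\<^esub>" for W
  proof -
    obtain w where w: "edges b w \<subseteq> E" "path b w = b" "cls w = word_eval P \<epsilon> W" "?K (lift_word b w) = ?K W"
      using loop[OF W(1)] by blast
    have "(w, []) \<in> pres_rel X R"
      using w(3) W(2) over[OF w(1)] by (simp add: one_pres_group cls_eq_iff)
    then have "(move R m)\<^sup>*\<^sup>* w []" by (rule reducible[OF over[OF w(1)]])
    moreover have "reachable b E b" using bV by (simp add: V_def)
    ultimately have "?K (lift_word b w) = \<one>\<^bsub>Q.P\<^esub>"
      using reducible_loop_trivial[OF K(1) _ min K(2) cells] w(1,2) by blast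
    then show ?thesis using Q.word_eval_gen_eq_one[OF W(1)] w(4) by simp
  qed
  show ?thesis
  proof (rule finitely_presentedI[where A = E and S = S and f = \<epsilon>])
    show "group ?H" using H P.is_group by (rule subgroup.subgroup_is_group)
    show "finite E" using sub by (simp add: subcomplex_def)
    show "finite S" using sub finV by (simp add: S_def subcomplex_def)
    show "\<epsilon> ` E \<subseteq> carrier ?H" using \<epsilon>H by simp
    show "word_eval ?H \<epsilon> s = \<one>\<^bsub>?H\<^esub>" if "s \<in> S" for s
      using H_eval[OF S_over[OF that]] S_eval[OF that] by simp
    show "\<exists>w. word_over E w \<and> word_eval ?H \<epsilon> w = h" if "h \<in> carrier ?H" for h
      using surj[of h] that H_eval by auto
    show "(w, []) \<in> pres_rel E S" if "word_over E w" "word_eval ?H \<epsilon> w = \<one>\<^bsub>?H\<^esub>" for w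
      using ker[of w] that H_eval by simp
  qed (rule S_over)
qed

end

section \<open>Cosets of a subgroup as the vertices of its cover\<close>

theorem theorem6p1:
  fixes X :: "'a set" and R :: "'a word set" and m :: "'a word \<Rightarrow> nat"
  assumes "finite_presentation X R"
    and "\<forall>r\<in>R. cyclically_reduced r"
    and "\<forall>r\<in>R. m r > 0"
    and "matching_property X R m"
    and "\<forall>w. word_over X w \<and> (w, []) \<in> pres_rel X R \<longrightarrow> (move R m)\<^sup>*\<^sup>* w []"
  shows "coherent (pres_group X R)"
  unfolding coherent_def
proof (intro allI impI)
  fix H assume fg: "finitely_generated_subgroup (pres_group X R) H"
  interpret presentation X R
    using assms(1) by unfold_locales (simp add: finite_presentation_def)
  interpret P: group P by (rule group_pres_group)
  obtain A where A: "finite A" "A \<subseteq> carrier P" "H = generate P A" and H: "subgroup H P"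
    using fg by (auto simp: finitely_generated_subgroup_def)
  have HP: "H \<subseteq> carrier P" using H by (rule subgroup.subset)
  \<comment> \<open>Letters translate subsets of the group from the right; the orbit of
    \<open>H\<close> consists of its right cosets. Everything else is left fixed, so that each
    letter acts bijectively on the whole type.\<close>
  define act where "act v l = (if v \<subseteq> carrier P \<and> fst l \<in> X then v #>\<^bsub>P\<^esub> cls [l] else v)"
    for v and l :: "'a \<times> bool"
  have act_closed: "act v l \<subseteq> carrier P" if "v \<subseteq> carrier P" for v l
    using that by (auto simp: act_def P.r_coset_subset_G)
  have path: "foldl act v w = v #>\<^bsub>P\<^esub> cls w" if "v \<subseteq> carrier P" "word_over X w" for v w
    using that
  proof (induction w arbitrary: v)
    case Nil
    then show ?case by (simp add: one_pres_group[symmetric])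
  next
    case (Cons l w)
    then show ?case
      using act_closed[of v l] mult_cls[of "[l]" w] by (simp add: act_def P.coset_mult_assoc)
  qed
  have path': "foldl act v w = v" if "\<not> v \<subseteq> carrier P" for v w
    using that by (induction w) (auto simp: act_def)
  have "act (act v l) (inv_letter l) = v" for v l
  proof (cases "v \<subseteq> carrier P \<and> fst l \<in> X")
    case True
    then have "foldl act v [l, inv_letter l] = v #>\<^bsub>P\<^esub> cls [l, inv_letter l]"
      by (intro path) auto
    moreover have "cls [l, inv_letter l] = \<one>\<^bsub>P\<^esub>"
      using pres_rel_inv_right[of "[l]"] True by (simp add: one_pres_group cls_eq_iff)
    ultimately show ?thesis using True by simp
  qed (auto simp: act_def)
  then interpret L: letter_action act by unfold_locales
  have "\<exists>w. word_over X w \<and> cls w = a" if "a \<in> A" for a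
    using that A(2) carrier_pres_group by auto
  then obtain wd where wd: "\<And>a. a \<in> A \<Longrightarrow> word_over X (wd a) \<and> cls (wd a) = a"
    by metis
  interpret relator_action act X R m H "\<Union>a\<in>A. L.edges H (wd a)"
  proof unfold_locales
    show "foldl act v r = v" if "r \<in> R" for v r
      using path[of v r] path'[of v r] relators_over[OF that] cls_relator[OF that]
      by (cases "v \<subseteq> carrier P") simp_all
  qed (use assms in \<open>auto simp: finite_presentation_def\<close>)
  show "finitely_presented (P\<lparr>carrier := H\<rparr>)"
  proof (rule stabilizer_finitely_presented[OF H _ _ A wd HOL.refl])
    show "foldl act H w = H \<longleftrightarrow> cls w \<in> H" if "word_over X w" for w
      using path[OF HP that] P.coset_join1[OF _ cls_closed[OF that] H] P.coset_join2[OF cls_closed[OF that] H]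
      by auto
    show "(move R m)\<^sup>*\<^sup>* w []" if "word_over X w" "(w, []) \<in> pres_rel X R" for w
      using assms(5) that by blast
  qed
qed

end
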